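(* Let $(X,\mu)$ be a measure space, $1\le p<\infty$, and $E$ a (normed) $PL$-space. Let $L_p(X):=L_p(X,\mathbb{C})$ and $L_p(X,E)$ be endowed with their $PL$-norms (see context). Then the bilinear operator $\mathcal{R}:L_p(X)\times E\to L_p(X,E)$, taking $(z,x)$ to the $E$-valued function $t\mapsto z(t)x$, $t\in X$, is $L$-contractive.
   Context: All linear spaces are complex. $H$ is a fixed separable infinite-dimensional Hilbert space, $\mathcal{B}$ is the algebra of bounded operators on $H$ with the operator norm. For a linear space $E$, $HE:=H\otimes E$ (algebraic tensor product), with elementary tensors written $\xi x$; it is a left $\mathcal{B}$-module via $a\cdot(\xi x):=a(\xi)x$. A (normed) $PL$-space is a linear space $E$ together with a norm on $HE$ (the $PL$-norm) such that $\|a\cdot u\|\le\|a\|\|u\|$ for all $a\in\mathcal{B}$, $u\in HE$. Its underlying normed space is $E$ with $\|x\|:=\|\xi x\|$ for any $\xi\in H$, $\|\xi\|=1$ (independent of $\xi$). $\mathbb{C}$ has the unique $PL$-norm with underlying norm $|\cdot|$, given by $H\mathbb{C}=H$. For a normed $PL$-space $F$, the usual (Bochner) space $L_p(X,F)$ of $F$-valued functions is made a $PL$-space by setting, for $u=\sum_k\xi_kx_k\in H(L_p(X,F))$, $\|u\|:=\big(\int_X\|\sum_k\xi_k(x_k(t))\|_{HF}^p\,d\mu(t)\big)^{1/p}$, i.e. the norm of the $HF$-valued function $t\mapsto\sum_k\xi_k(x_k(t))$ in $L_p(X,HF)$. Fix a unitary isomorphism $\iota$ from the Hilbert tensor product $H\widehat\otimes_{hil}H$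 onto $H$, and put $\xi\diamondsuit\eta:=\iota(\xi\otimes\eta)$. A bilinear operator $\mathcal{R}:E\times F\to G$ has amplification $\mathcal{R}_\infty:HE\times HF\to HG$, well defined by $\mathcal{R}_\infty(\xi x,\eta y)=(\xi\diamondsuit\eta)\mathcal{R}(x,y)$; between $PL$-spaces, $\mathcal{R}$ is $L$-contractive if $\mathcal{R}_\infty$ is contractive. *)

theory Defs
  imports
    "HOL-Analysis.Analysis"
    "HOL-Algebra.Module"
    "HOL-Algebra.QuotRing"
    "HOL-Algebra.Algebraic_Closure_Type"
    "HOL-Library.Poly_Mapping"
begin

section \<open>Complex Hilbert spaces\<close>

text \<open>The inner product is linear in the first argument. Completeness comes from \<^class>\<open>banach\<close>.\<close>

class complex_hilbert = banach +
  fixes scaleC :: "complex \<Rightarrow> 'a \<Rightarrow> 'a"  (infixr "*\<^sub>C" 75)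
    and cinner :: "'a \<Rightarrow> 'a \<Rightarrow> complex"
  assumes scaleC_add_right: "c *\<^sub>C (x + y) = c *\<^sub>C x + c *\<^sub>C y"
    and scaleC_add_left: "(c + d) *\<^sub>C x = c *\<^sub>C x + d *\<^sub>C x"
    and scaleC_scaleC: "c *\<^sub>C (d *\<^sub>C x) = (c * d) *\<^sub>C x"
    and scaleC_of_real: "complex_of_real r *\<^sub>C x = r *\<^sub>R x"
    and cinner_add_left: "cinner (x + y) z = cinner x z + cinner y z"
    and cinner_scaleC_left: "cinner (c *\<^sub>C x) y = c * cinner x y"
    and cinner_commute: "cinner y x = cnj (cinner x y)"
    and cinner_self: "cinner x x = complex_of_real ((norm x)\<^sup>2)"

definition infinite_dimensional :: "'h::complex_hilbert itself \<Rightarrow> bool" where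
  "infinite_dimensional _ \<longleftrightarrow>
     \<not> (\<exists>B :: 'h set. finite B \<and> module.span (*\<^sub>C) B = (UNIV :: 'h set))"

definition clinear_map :: "('a::complex_hilbert \<Rightarrow> 'b::complex_hilbert) \<Rightarrow> bool" where
  "clinear_map a \<longleftrightarrow>
     (\<forall>x y. a (x + y) = a x + a y) \<and> (\<forall>c x. a (c *\<^sub>C x) = c *\<^sub>C a x)"

definition unitary :: "('a::complex_hilbert \<Rightarrow> 'b::complex_hilbert) \<Rightarrow> bool" where
  "unitary U \<longleftrightarrow> clinear_map U \<and> surj U \<and> (\<forall>x y. cinner (U x) (U y) = cinner x y)"


section \<open>Complex linear spaces and algebraic tensor products\<close>

text \<open>A complex linear space is a \<open>module\<close> (in the sense of HOL-Algebra) over the field of complex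
  numbers. The \<open>mult\<close> and \<open>one\<close> fields of the record play no role and are left undefined.\<close>

abbreviation complex_ring :: "complex ring" where
  "complex_ring \<equiv> ring_of_type_algebra"

definition hilbert_module :: "(complex, 'h::complex_hilbert) module" where
  "hilbert_module = \<lparr>carrier = UNIV, mult = undefined, one = undefined,
     zero = 0, add = (+), smult = (*\<^sub>C)\<rparr>"

definition complex_module :: "(complex, complex) module" where
  "complex_module = \<lparr>carrier = UNIV, mult = undefined, one = undefined,
     zero = 0, add = (+), smult = (*)\<rparr>"

definition quotient_module :: "('c, 'a, 'm) module_scheme \<Rightarrow> 'a set \<Rightarrow> ('c, 'a set) module" where
  "quotient_module V N = \<lparr>carrier = a_rcosets\<^bsub>V\<^esub> N, mult = undefined, one = undefined,
     zero = N, add = set_add V, smult = (\<lambda>c A. \<Union>x\<in>A. N +>\<^bsub>V\<^esub> (c \<odot>\<^bsub>V\<^esub> x))\<rparr>"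

definition free_module :: "'s set \<Rightarrow> (complex, 's \<Rightarrow>\<^sub>0 complex) module" where
  "free_module S = \<lparr>carrier = {f. Poly_Mapping.keys f \<subseteq> S}, mult = undefined, one = undefined,
     zero = 0, add = (+), smult = (\<lambda>c. Poly_Mapping.map ((*) c))\<rparr>"

definition tensor_relations ::
  "(complex, 'u, 'm) module_scheme \<Rightarrow> (complex, 'v, 'n) module_scheme \<Rightarrow> ('u \<times> 'v \<Rightarrow>\<^sub>0 complex) set" where
  "tensor_relations U V =
     (\<lambda>N. submodule N complex_ring (free_module (carrier U \<times> carrier V))) hull
     (let e = (\<lambda>u v. Poly_Mapping.single (u, v) (1 :: complex));
          sc = (\<lambda>c. Poly_Mapping.map ((*) (c :: complex)))
      in {e (u \<oplus>\<^bsub>U\<^esub> u') v - e u v - e u' v | u u' v. u \<in> carrier U \<and> u' \<in> carrier U \<and> v \<in> carrier V}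
       \<union> {e u (v \<oplus>\<^bsub>V\<^esub> v') - e u v - e u v' | u v v'. u \<in> carrier U \<and> v \<in> carrier V \<and> v' \<in> carrier V}
       \<union> {e (c \<odot>\<^bsub>U\<^esub> u) v - sc c (e u v) | c u v. u \<in> carrier U \<and> v \<in> carrier V}
       \<union> {e u (c \<odot>\<^bsub>V\<^esub> v) - sc c (e u v) | c u v. u \<in> carrier U \<and> v \<in> carrier V})"

definition tensor ::
  "(complex, 'u, 'm) module_scheme \<Rightarrow> (complex, 'v, 'n) module_scheme
     \<Rightarrow> (complex, ('u \<times> 'v \<Rightarrow>\<^sub>0 complex) set) module" where
  "tensor U V = quotient_module (free_module (carrier U \<times> carrier V)) (tensor_relations U V)"

definition elem_tensor ::
  "(complex, 'u, 'm) module_scheme \<Rightarrow> (complex, 'v, 'n) module_scheme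
     \<Rightarrow> 'u \<Rightarrow> 'v \<Rightarrow> ('u \<times> 'v \<Rightarrow>\<^sub>0 complex) set" where
  "elem_tensor U V u v =
     tensor_relations U V +>\<^bsub>free_module (carrier U \<times> carrier V)\<^esub> Poly_Mapping.single (u, v) 1"


section \<open>The Hilbert tensor product\<close>

text \<open>The Hilbert tensor product is the completion of the algebraic tensor product with respect to
  the inner product determined by
  \<open>\<langle>\<xi> \<otimes> \<eta>, \<xi>' \<otimes> \<eta>'\<rangle> = \<langle>\<xi>, \<xi>'\<rangle> \<langle>\<eta>, \<eta>'\<rangle>\<close>. As usual, a completion is a complete space
  \<open>'t\<close> together with an isometric embedding \<open>j\<close> with dense range.\<close>

definition hilbert_tensor_product ::
  "(('a::complex_hilbert \<times> 'b::complex_hilbert \<Rightarrow>\<^sub>0 complex) set \<Rightarrow> 't::complex_hilbert) \<Rightarrow> bool" where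
  "hilbert_tensor_product j \<longleftrightarrow>
     (let T = tensor (hilbert_module :: (complex, 'a) module) (hilbert_module :: (complex, 'b) module);
          e = elem_tensor hilbert_module hilbert_module
      in (\<forall>u\<in>carrier T. \<forall>v\<in>carrier T. j (u \<oplus>\<^bsub>T\<^esub> v) = j u + j v)
       \<and> (\<forall>c. \<forall>u\<in>carrier T. j (c \<odot>\<^bsub>T\<^esub> u) = c *\<^sub>C j u)
       \<and> (\<forall>\<xi> \<eta> \<xi>' \<eta>'. cinner (j (e \<xi> \<eta>)) (j (e \<xi>' \<eta>')) = cinner \<xi> \<xi>' * cinner \<eta> \<eta>')
       \<and> closure (j ` carrier T) = UNIV)"

definition diamond ::
  "('t::complex_hilbert \<Rightarrow> 'h::complex_hilbert) \<Rightarrow> (('h \<times> 'h \<Rightarrow>\<^sub>0 complex) set \<Rightarrow> 't)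
     \<Rightarrow> 'h \<Rightarrow> 'h \<Rightarrow> 'h" where
  "diamond \<iota> j \<xi> \<eta> = \<iota> (j (elem_tensor hilbert_module hilbert_module \<xi> \<eta>))"


section \<open>PL-spaces\<close>

abbreviation H_tensor ::
  "(complex, 'e, 'm) module_scheme \<Rightarrow> (complex, ('h::complex_hilbert \<times> 'e \<Rightarrow>\<^sub>0 complex) set) module" where
  "H_tensor E \<equiv> tensor hilbert_module E"

text \<open>\<open>tensor_sum E n \<xi> x\<close> is the element \<open>\<Sum>k<n. \<xi>\<^sub>k x\<^sub>k\<close> of \<open>H \<otimes> E\<close>. Below, functions on \<open>H \<otimes> E\<close>
  given by a formula on such representations are rendered by definite descriptions over all
  representations.\<close>

definition tensor_sum ::
  "(complex, 'e, 'm) module_scheme \<Rightarrow> nat \<Rightarrow> (nat \<Rightarrow> 'h::complex_hilbert) \<Rightarrow> (nat \<Rightarrow> 'e)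
     \<Rightarrow> ('h \<times> 'e \<Rightarrow>\<^sub>0 complex) set" where
  "tensor_sum E n \<xi> x = (\<Oplus>\<^bsub>H_tensor E\<^esub>k\<in>{..<n}. elem_tensor hilbert_module E (\<xi> k) (x k))"

definition H_action ::
  "(complex, 'e, 'm) module_scheme \<Rightarrow> ('h::complex_hilbert \<Rightarrow> 'h)
     \<Rightarrow> ('h \<times> 'e \<Rightarrow>\<^sub>0 complex) set \<Rightarrow> ('h \<times> 'e \<Rightarrow>\<^sub>0 complex) set" where
  "H_action E a u = (THE w. \<exists>n \<xi> x. (\<forall>k<n. x k \<in> carrier E) \<and>
     u = tensor_sum E n \<xi> x \<and> w = tensor_sum E n (\<lambda>k. a (\<xi> k)) x)"

definition is_norm :: "(complex, 'v, 'm) module_scheme \<Rightarrow> ('v \<Rightarrow> real) \<Rightarrow> bool" where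
  "is_norm V N \<longleftrightarrow>
     (\<forall>u\<in>carrier V. 0 \<le> N u \<and> (N u = 0 \<longleftrightarrow> u = \<zero>\<^bsub>V\<^esub>)) \<and>
     (\<forall>u\<in>carrier V. \<forall>v\<in>carrier V. N (u \<oplus>\<^bsub>V\<^esub> v) \<le> N u + N v) \<and>
     (\<forall>c. \<forall>u\<in>carrier V. N (c \<odot>\<^bsub>V\<^esub> u) = cmod c * N u)"

record ('h, 'e) pl_space = "(complex, 'e) module" +
  pl_norm :: "('h \<times> 'e \<Rightarrow>\<^sub>0 complex) set \<Rightarrow> real"

definition normed_pl_space :: "('h::complex_hilbert, 'e) pl_space \<Rightarrow> bool" where
  "normed_pl_space E \<longleftrightarrow>
     Module.module complex_ring E \<and>
     is_norm (H_tensor E :: (complex, ('h \<times> 'e \<Rightarrow>\<^sub>0 complex) set) module) (pl_norm E) \<and>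
     (\<forall>a :: 'h \<Rightarrow> 'h. \<forall>u \<in> carrier (H_tensor E). clinear_map a \<longrightarrow> bounded_linear a \<longrightarrow>
        pl_norm E (H_action E a u) \<le> onorm a * pl_norm E u)"

definition underlying_norm :: "('h::complex_hilbert, 'e) pl_space \<Rightarrow> 'e \<Rightarrow> real" where
  "underlying_norm E x =
     (THE r. \<forall>\<xi> :: 'h. norm \<xi> = 1 \<longrightarrow> pl_norm E (elem_tensor hilbert_module E \<xi> x) = r)"

definition complex_pl :: "('h::complex_hilbert, complex) pl_space" where
  "complex_pl = module.extend complex_module (pl_space.fields
     (\<lambda>u. THE r. \<exists>n (\<xi> :: nat \<Rightarrow> 'h) c.
        u = tensor_sum complex_module n \<xi> c \<and> r = norm (\<Sum>k<n. c k *\<^sub>C \<xi> k)))"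


section \<open>Bochner spaces\<close>

text \<open>\<open>V\<close> is a linear space with norm \<open>N\<close>; it need be neither separable nor complete, so
  measurability means being a pointwise limit of simple functions. Functions on \<open>X\<close> are extensional
  on the carrier of the measure space.\<close>

definition strongly_measurable ::
  "'x measure \<Rightarrow> (complex, 'v, 'm) module_scheme \<Rightarrow> ('v \<Rightarrow> real) \<Rightarrow> ('x \<Rightarrow> 'v) \<Rightarrow> bool" where
  "strongly_measurable M V N f \<longleftrightarrow>
     (\<exists>s. (\<forall>n::nat. simple_function M (s n) \<and> s n \<in> space M \<rightarrow> carrier V) \<and>
          (\<forall>t\<in>space M. (\<lambda>n. N (s n t \<ominus>\<^bsub>V\<^esub> f t)) \<longlonglongrightarrow> 0))"

definition Lp_fun ::
  "real \<Rightarrow> 'x measure \<Rightarrow> (complex, 'v, 'm) module_scheme \<Rightarrow> ('v \<Rightarrow> real)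
     \<Rightarrow> (complex, 'x \<Rightarrow> 'v) module" where
  "Lp_fun p M V N = \<lparr>
     carrier = {f \<in> space M \<rightarrow>\<^sub>E carrier V.
       strongly_measurable M V N f \<and> integrable M (\<lambda>t. N (f t) powr p)},
     mult = undefined, one = undefined,
     zero = (\<lambda>t\<in>space M. \<zero>\<^bsub>V\<^esub>),
     add = (\<lambda>f g. \<lambda>t\<in>space M. f t \<oplus>\<^bsub>V\<^esub> g t),
     smult = (\<lambda>c f. \<lambda>t\<in>space M. c \<odot>\<^bsub>V\<^esub> f t)\<rparr>"

definition Lp_null ::
  "real \<Rightarrow> 'x measure \<Rightarrow> (complex, 'v, 'm) module_scheme \<Rightarrow> ('v \<Rightarrow> real) \<Rightarrow> ('x \<Rightarrow> 'v) set" where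
  "Lp_null p M V N = {f \<in> carrier (Lp_fun p M V N). AE t in M. f t = \<zero>\<^bsub>V\<^esub>}"

definition Lp_space ::
  "real \<Rightarrow> 'x measure \<Rightarrow> (complex, 'v, 'm) module_scheme \<Rightarrow> ('v \<Rightarrow> real)
     \<Rightarrow> (complex, ('x \<Rightarrow> 'v) set) module" where
  "Lp_space p M V N = quotient_module (Lp_fun p M V N) (Lp_null p M V N)"

definition Lp_class ::
  "real \<Rightarrow> 'x measure \<Rightarrow> (complex, 'v, 'm) module_scheme \<Rightarrow> ('v \<Rightarrow> real) \<Rightarrow> ('x \<Rightarrow> 'v) \<Rightarrow> ('x \<Rightarrow> 'v) set" where
  "Lp_class p M V N f = Lp_null p M V N +>\<^bsub>Lp_fun p M V N\<^esub> f"

definition Lp_pl ::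
  "real \<Rightarrow> 'x measure \<Rightarrow> ('h::complex_hilbert, 'f) pl_space \<Rightarrow> ('h, ('x \<Rightarrow> 'f) set) pl_space" where
  "Lp_pl p M F = module.extend (Lp_space p M F (underlying_norm F)) (pl_space.fields
     (\<lambda>u. THE r. \<exists>n (\<xi> :: nat \<Rightarrow> 'h) f.
        (\<forall>k<n. f k \<in> carrier (Lp_fun p M F (underlying_norm F))) \<and>
        u = tensor_sum (Lp_space p M F (underlying_norm F)) n \<xi>
              (\<lambda>k. Lp_class p M F (underlying_norm F) (f k)) \<and>
        r = (LINT t|M. pl_norm F (tensor_sum F n \<xi> (\<lambda>k. f k t)) powr p) powr (1 / p)))"


section \<open>L-contractive bilinear operators\<close>

definition bilinear_operator ::
  "(complex, 'e, 'k) module_scheme \<Rightarrow> (complex, 'f, 'l) module_scheme \<Rightarrow> (complex, 'g, 'm) module_scheme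
     \<Rightarrow> ('e \<Rightarrow> 'f \<Rightarrow> 'g) \<Rightarrow> bool" where
  "bilinear_operator E F G R \<longleftrightarrow>
     (\<forall>x\<in>carrier E. \<forall>y\<in>carrier F. R x y \<in> carrier G) \<and>
     (\<forall>x\<in>carrier E. \<forall>x'\<in>carrier E. \<forall>y\<in>carrier F. R (x \<oplus>\<^bsub>E\<^esub> x') y = R x y \<oplus>\<^bsub>G\<^esub> R x' y) \<and>
     (\<forall>x\<in>carrier E. \<forall>y\<in>carrier F. \<forall>y'\<in>carrier F. R x (y \<oplus>\<^bsub>F\<^esub> y') = R x y \<oplus>\<^bsub>G\<^esub> R x y') \<and>
     (\<forall>c. \<forall>x\<in>carrier E. \<forall>y\<in>carrier F. R (c \<odot>\<^bsub>E\<^esub> x) y = c \<odot>\<^bsub>G\<^esub> R x y) \<and>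
     (\<forall>c. \<forall>x\<in>carrier E. \<forall>y\<in>carrier F. R x (c \<odot>\<^bsub>F\<^esub> y) = c \<odot>\<^bsub>G\<^esub> R x y)"

definition amplification ::
  "('h \<Rightarrow> 'h \<Rightarrow> 'h::complex_hilbert) \<Rightarrow> (complex, 'e, 'k) module_scheme \<Rightarrow> (complex, 'f, 'l) module_scheme
     \<Rightarrow> (complex, 'g, 'm) module_scheme \<Rightarrow> ('e \<Rightarrow> 'f \<Rightarrow> 'g)
     \<Rightarrow> ('h \<times> 'e \<Rightarrow>\<^sub>0 complex) set \<Rightarrow> ('h \<times> 'f \<Rightarrow>\<^sub>0 complex) set \<Rightarrow> ('h \<times> 'g \<Rightarrow>\<^sub>0 complex) set" where
  "amplification dia E F G R u v = (THE w. \<exists>m \<xi> x n \<eta> y.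
     (\<forall>i<m. x i \<in> carrier E) \<and> u = tensor_sum E m \<xi> x \<and>
     (\<forall>k<n. y k \<in> carrier F) \<and> v = tensor_sum F n \<eta> y \<and>
     w = (\<Oplus>\<^bsub>H_tensor G\<^esub>i\<in>{..<m}. tensor_sum G n (\<lambda>k. dia (\<xi> i) (\<eta> k)) (\<lambda>k. R (x i) (y k))))"

definition L_contractive ::
  "('h \<Rightarrow> 'h \<Rightarrow> 'h::complex_hilbert) \<Rightarrow> ('h, 'e) pl_space \<Rightarrow> ('h, 'f) pl_space \<Rightarrow> ('h, 'g) pl_space
     \<Rightarrow> ('e \<Rightarrow> 'f \<Rightarrow> 'g) \<Rightarrow> bool" where
  "L_contractive dia E F G R \<longleftrightarrow> bilinear_operator E F G R \<and>
     (\<forall>u\<in>carrier (H_tensor E). \<forall>v\<in>carrier (H_tensor F).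
        pl_norm G (amplification dia E F G R u v) \<le> pl_norm E u * pl_norm F v)"

text \<open>The class of \<open>z\<close> together with the vector \<open>x\<close> is sent to the class of \<open>t \<mapsto> z(t) x\<close>.\<close>

definition scalar_times_vector ::
  "real \<Rightarrow> 'x measure \<Rightarrow> ('h::complex_hilbert, 'e) pl_space
     \<Rightarrow> ('x \<Rightarrow> complex) set \<Rightarrow> 'e \<Rightarrow> ('x \<Rightarrow> 'e) set" where
  "scalar_times_vector p M E Z x =
     (THE A. \<exists>z\<in>Z. A = Lp_class p M E (underlying_norm E) (\<lambda>t\<in>space M. z t \<odot>\<^bsub>E\<^esub> x))"

end

theory Submission
  imports Defs
begin

text \<open>
  Write \<open>u = \<Sum> \<xi>\<^sub>i [z\<^sub>i]\<close> and \<open>v = \<Sum> \<eta>\<^sub>k x\<^sub>k\<close>. The amplification at \<open>(u, v)\<close> is represented by the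
  \<open>HE\<close>-valued function \<open>t \<mapsto> \<Sum> (\<xi>\<^sub>i \<diamond> \<eta>\<^sub>k) z\<^sub>i(t) x\<^sub>k = \<Sum> (\<zeta>(t) \<diamond> \<eta>\<^sub>k) x\<^sub>k\<close> with \<open>\<zeta>(t) = \<Sum> z\<^sub>i(t) \<xi>\<^sub>i\<close>.
  Its value at \<open>t\<close> is the image of \<open>v\<close> under the operator \<open>\<eta> \<mapsto> \<zeta>(t) \<diamond> \<eta>\<close>, whose norm is at most
  \<open>\<parallel>\<zeta>(t)\<parallel>\<close>, so the pointwise norm is at most \<open>\<parallel>\<zeta>(t)\<parallel> \<parallel>v\<parallel>\<close>. The \<open>L\<^sub>p\<close>-norm of \<open>\<parallel>\<zeta>\<parallel>\<close> is \<open>\<parallel>u\<parallel>\<close>.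

  The definite descriptions for the norms, the action of operators and the amplification are well
  defined by the universal property of the tensor product.
\<close>

section \<open>Complex linear spaces\<close>

text \<open>The obstacle is that the norms of \<open>complex_pl\<close> and \<open>Lp_pl\<close> and
  the amplification are definite descriptions over all representations of a tensor: nothing can be
  estimated before independence of the representation is known. For \<open>Lp_pl\<close> the
  comparison has to pass through evaluation at a point, which is not defined on classes. Two
  representations then agree only almost everywhere, which is enough for their integrals to agree.

  The PL axiom acts twice: on rank-one operators, to make the underlying norm independent of the
  unit vector, and on the operators \<open>\<eta> \<mapsto> \<zeta>(t) \<diamond> \<eta>\<close>.
  The bound for the latter comes from \<open>\<parallel>\<xi> \<diamond> \<eta>\<parallel> =
  \<parallel>\<xi>\<parallel> \<parallel>\<eta>\<parallel>\<close>, as \<open>\<iota>\<close> is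
  unitary and \<open>j\<close> is multiplicative on inner products of elementary tensors. Since
  \<open>\<parallel>v\<parallel>\<close> does not depend on \<open>t\<close>, it leaves the integral
  as a p-th power and the constant is exactly 1. Infinite dimension enters through the existence of
  a unit vector, without which the description of \<open>underlying_norm\<close> would single out no
  number.\<close>

lemma complex_ring_simps [simp]:
  "carrier complex_ring = UNIV" "x \<otimes>\<^bsub>complex_ring\<^esub> y = x * y" "\<one>\<^bsub>complex_ring\<^esub> = 1"
  "\<zero>\<^bsub>complex_ring\<^esub> = 0" "x \<oplus>\<^bsub>complex_ring\<^esub> y = x + y"
  by (simp_all add: ring_of_type_algebra_def)

text \<open>The carrier of \<open>complex_ring\<close> is the whole type, so the module laws can be
  restated here without membership premises on scalars.\<close>

locale complex_linear = module complex_ring V for V :: "(complex, 'v, 'm) module_scheme" (structure)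
begin

lemma smult_in_carrier [simp, intro]: "x \<in> carrier V \<Longrightarrow> c \<odot> x \<in> carrier V"
  by simp

lemma
  assumes "x \<in> carrier V"
  shows smult_add_left: "(c + d) \<odot> x = c \<odot> x \<oplus> d \<odot> x"
    and smult_mult: "(c * d) \<odot> x = c \<odot> (d \<odot> x)"
    and smult_1 [simp]: "1 \<odot> x = x"
    and smult_0 [simp]: "0 \<odot> x = \<zero>"
  using smult_l_distr[of c d x] smult_assoc1[of c d x] smult_one[of x] smult_l_null[of x] assms
  by simp_all

lemma smult_add_right: "x \<in> carrier V \<Longrightarrow> y \<in> carrier V \<Longrightarrow> c \<odot> (x \<oplus> y) = c \<odot> x \<oplus> c \<odot> y"
  by (simp add: smult_r_distr)

lemma smult_zero_right [simp]: "c \<odot> \<zero> = \<zero>"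
  by (rule smult_r_null) simp

lemma smult_diff_right: "x \<in> carrier V \<Longrightarrow> y \<in> carrier V \<Longrightarrow> c \<odot> (x \<ominus> y) = c \<odot> x \<ominus> c \<odot> y"
  by (simp add: a_minus_def smult_r_distr smult_r_minus)

lemma minus_eq_smult:
  assumes "x \<in> carrier V"
  shows "\<ominus> x = (-1) \<odot> x"
proof (rule M.minus_equality)
  show "(-1) \<odot> x \<oplus> x = \<zero>"
    using smult_add_left[OF assms, of "-1" 1] assms by simp
qed (use assms in auto)

lemma diff_zero [simp]: "x \<in> carrier V \<Longrightarrow> x \<ominus> \<zero> = x"
  by (simp add: a_minus_def minus_eq_smult)

lemma diff_eq_zero_iff [simp]:
  assumes "x \<in> carrier V" "y \<in> carrier V"
  shows "x \<ominus> y = \<zero> \<longleftrightarrow> x = y"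
  using M.add.inv_solve_right[of \<zero> x y] assms by (auto simp: a_minus_def)

lemma add_diff_cancel_left [simp]:
  assumes "x \<in> carrier V" "y \<in> carrier V"
  shows "(x \<oplus> y) \<ominus> x = y"
  using M.add.inv_solve_right[of y "x \<oplus> y" x] assms by (simp add: a_minus_def M.a_comm)

lemma finsum_lessThan_Suc:
  fixes n :: nat
  assumes "\<And>k. k < Suc n \<Longrightarrow> f k \<in> carrier V"
  shows "(\<Oplus>k\<in>{..<Suc n}. f k) = (\<Oplus>k\<in>{..<n}. f k) \<oplus> f n"
  using assms by (simp add: lessThan_Suc M.finsum_insert Pi_def M.a_comm)

lemma finsum_lessThan_add:
  fixes m n :: nat
  assumes "\<And>k. k < m + n \<Longrightarrow> f k \<in> carrier V"
  shows "(\<Oplus>k\<in>{..<m + n}. f k) = (\<Oplus>k\<in>{..<m}. f k) \<oplus> (\<Oplus>k\<in>{..<n}. f (m + k))"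
  using assms
proof (induction n)
  case (Suc n)
  then show ?case
    by (simp add: finsum_lessThan_Suc Pi_def M.a_assoc)
qed (simp add: Pi_def)

text \<open>An amplification is a double sum, while \<open>tensor_sum\<close> has a single index.
  The bijection \<open>l \<mapsto> (l div n, l mod n)\<close> passes from one to the other.\<close>

lemma finsum_lessThan_mult:
  fixes m n :: nat
  assumes "\<And>i k. i < m \<Longrightarrow> k < n \<Longrightarrow> f i k \<in> carrier V"
  shows "(\<Oplus>l\<in>{..<m * n}. f (l div n) (l mod n)) = (\<Oplus>i\<in>{..<m}. \<Oplus>k\<in>{..<n}. f i k)"
  using assms
proof (induction m)
  case (Suc m)
  \<comment> \<open>For \<open>n = 0\<close> there is no such \<open>l\<close>, so division by zero
    never matters.\<close>
  have dm: "l div n < m' \<and> l mod n < n" if "l < m' * n" for l m'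
    using that by (cases "n = 0") (auto simp: less_mult_imp_div_less)
  have "(\<Oplus>l\<in>{..<Suc m * n}. f (l div n) (l mod n)) =
      (\<Oplus>l\<in>{..<m * n + n}. f (l div n) (l mod n))"
    by (simp add: add.commute)
  also have "\<dots> = (\<Oplus>l\<in>{..<m * n}. f (l div n) (l mod n))
      \<oplus> (\<Oplus>k\<in>{..<n}. f ((m * n + k) div n) ((m * n + k) mod n))"
    using dm[of _ "Suc m"] Suc.prems by (intro finsum_lessThan_add) (auto simp: add.commute)
  also have "(\<Oplus>k\<in>{..<n}. f ((m * n + k) div n) ((m * n + k) mod n)) = (\<Oplus>k\<in>{..<n}. f m k)"
    using Suc.prems by (intro M.finsum_cong') auto
  finally show ?case
    using Suc by (simp add: finsum_lessThan_Suc Pi_def)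
qed simp

end

lemma complex_linearI:
  fixes V (structure)
  assumes "abelian_group V"
    and "\<And>c x. x \<in> carrier V \<Longrightarrow> c \<odot> x \<in> carrier V"
    and "\<And>c d x. x \<in> carrier V \<Longrightarrow> (c + d) \<odot> x = c \<odot> x \<oplus> d \<odot> x"
    and "\<And>c x y. x \<in> carrier V \<Longrightarrow> y \<in> carrier V \<Longrightarrow> c \<odot> (x \<oplus> y) = c \<odot> x \<oplus> c \<odot> y"
    and "\<And>c d x. x \<in> carrier V \<Longrightarrow> (c * d) \<odot> x = c \<odot> (d \<odot> x)"
    and "\<And>x. x \<in> carrier V \<Longrightarrow> 1 \<odot> x = x"
  shows "complex_linear V"
  unfolding complex_linear_def
  by (rule moduleI) (use assms in \<open>auto intro: cring_from_type_algebra\<close>)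

lemma complex_linear_hilbert_module: "complex_linear hilbert_module"
proof (rule complex_linearI)
  show "abelian_group (hilbert_module :: (complex, 'a::complex_hilbert) module)"
    by (rule abelian_groupI)
      (auto simp: hilbert_module_def algebra_simps intro: exI[of _ "- x" for x] left_minus)
  fix x :: 'a
  show "1 \<odot>\<^bsub>hilbert_module\<^esub> x = x"
    using scaleC_of_real[of 1 x] by (simp add: hilbert_module_def)
qed (auto simp: hilbert_module_def scaleC_add_left scaleC_add_right scaleC_scaleC)

lemma complex_linear_complex_module: "complex_linear complex_module"
proof (rule complex_linearI)
  show "abelian_group complex_module"
    by (rule abelian_groupI)
      (auto simp: complex_module_def algebra_simps intro: exI[of _ "- x" for x] left_minus)
qed (auto simp: complex_module_def algebra_simps)

section \<open>Quotients by submodules\<close>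

locale complex_quotient = complex_linear V + N: submodule N complex_ring V
  for N and V :: "(complex, 'v, 'm) module_scheme" (structure)
begin

sublocale abelian_subgroup N V
  by (rule abelian_subgroupI3) (simp_all add: additive_subgroup.intro N.subgroup_axioms M.abelian_group_axioms)

abbreviation "Q \<equiv> quotient_module V N"

lemma carrier_quotient: "carrier Q = (\<lambda>x. N +> x) ` carrier V"
  by (auto simp: quotient_module_def A_RCOSETS_def' )

lemma coset_in_quotient [simp, intro]: "x \<in> carrier V \<Longrightarrow> N +> x \<in> carrier Q"
  by (simp add: carrier_quotient)

lemma quotient_add:
  "x \<in> carrier V \<Longrightarrow> y \<in> carrier V \<Longrightarrow> (N +> x) \<oplus>\<^bsub>Q\<^esub> (N +> y) = N +> (x \<oplus> y)"
  by (simp add: quotient_module_def a_rcos_sum)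

lemma coset_eq_iff:
  assumes "x \<in> carrier V" "y \<in> carrier V"
  shows "N +> x = N +> y \<longleftrightarrow> x \<ominus> y \<in> N"
  using a_rcos_module_minus[OF ring.intro]
  by (metis a_rcos_module a_rcos_self a_repr_independence' assms M.minus_eq is_abelian_group)

text \<open>The quotient defines a scalar multiple as a union of cosets, one for each member of the
  given coset. Since \<open>N\<close> is closed under scalars, all of them coincide, and the given
  coset is nonempty.\<close>

lemma quotient_smult:
  assumes "x \<in> carrier V"
  shows "c \<odot>\<^bsub>Q\<^esub> (N +> x) = N +> (c \<odot> x)"
proof -
  have "N +> (c \<odot> y) = N +> (c \<odot> x)" if "y \<in> N +> x" for y
  proof -
    have y: "y \<in> carrier V"
      using that assms a_elemrcos_carrier by blast
    have "N +> y = N +> x"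
      using that assms a_repr_independence'[of y x] by simp
    then have "y \<ominus> x \<in> N"
      using coset_eq_iff[OF y assms] by blast
    then have "c \<odot> (y \<ominus> x) \<in> N"
      by (intro N.smult_closed) auto
    then show ?thesis
      by (simp only: coset_eq_iff[OF smult_in_carrier[OF y] smult_in_carrier[OF assms]]
          smult_diff_right[OF y assms])
  qed
  moreover have "x \<in> N +> x"
    using assms by (rule a_rcos_self)
  ultimately have "(\<Union>y\<in>N +> x. N +> (c \<odot> y)) = N +> (c \<odot> x)"
    by blast
  then show ?thesis
    by (simp add: quotient_module_def)
qed

lemma quotient_zero: "\<zero>\<^bsub>Q\<^esub> = N +> \<zero>"
  by (simp add: quotient_module_def a_coset_add_zero[OF a_subset])

lemma quotient_linear: "complex_linear Q"
proof (rule complex_linearI)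
  show "abelian_group Q"
  proof (rule abelian_groupI)
    fix A assume "A \<in> carrier Q"
    then obtain x where x: "x \<in> carrier V" "A = N +> x"
      by (auto simp: carrier_quotient)
    then have "(N +> (\<ominus> x)) \<oplus>\<^bsub>Q\<^esub> A = \<zero>\<^bsub>Q\<^esub>"
      by (simp add: quotient_add quotient_zero M.l_neg)
    then show "\<exists>B\<in>carrier Q. B \<oplus>\<^bsub>Q\<^esub> A = \<zero>\<^bsub>Q\<^esub>"
      using x by blast
  qed (auto simp: carrier_quotient quotient_add quotient_zero M.a_ac)
qed (auto simp: carrier_quotient quotient_add quotient_smult smult_add_left smult_add_right smult_mult)

end

section \<open>The algebraic tensor product\<close>

lemma complex_linear_free_module: "complex_linear (free_module S)"
proof (rule complex_linearI)
  show "abelian_group (free_module S)"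
  proof (rule abelian_groupI)
    fix f assume "f \<in> carrier (free_module S)"
    then show "\<exists>g\<in>carrier (free_module S). g \<oplus>\<^bsub>free_module S\<^esub> f = \<zero>\<^bsub>free_module S\<^esub>"
      by (intro bexI[of _ "- f"]) (auto simp: free_module_def in_keys_iff subset_iff)
  qed (use keys_add in \<open>fastforce simp: free_module_def algebra_simps\<close>)+
  show "c \<odot>\<^bsub>free_module S\<^esub> f \<in> carrier (free_module S)" if "f \<in> carrier (free_module S)" for c f
    using that by (auto simp: free_module_def in_keys_iff map.rep_eq when_def subset_iff)
  \<comment> \<open>\<open>Poly_Mapping.map\<close> acts on nonzero coefficients only, and
    coefficients of \<open>f\<close> and \<open>g\<close> may cancel in the sum. As
    \<open>c * 0 = 0\<close>, the guards do no harm.\<close>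
  show "c \<odot>\<^bsub>free_module S\<^esub> (f \<oplus>\<^bsub>free_module S\<^esub> g) =
      c \<odot>\<^bsub>free_module S\<^esub> f \<oplus>\<^bsub>free_module S\<^esub> c \<odot>\<^bsub>free_module S\<^esub> g" for c f g
    by (rule poly_mapping_eqI) (simp add: free_module_def lookup_add map.rep_eq when_mult distrib_left, simp add: when_def flip: distrib_left)
qed (auto simp: free_module_def lookup_add map.rep_eq when_def distrib_right intro!: poly_mapping_eqI)

section \<open>Linear extension from a free space\<close>

definition free_lift :: "(complex, 'w, 'm) module_scheme \<Rightarrow> ('s \<Rightarrow> 'w) \<Rightarrow> ('s \<Rightarrow>\<^sub>0 complex) \<Rightarrow> 'w" where
  "free_lift W B f = (\<Oplus>\<^bsub>W\<^esub>s\<in>Poly_Mapping.keys f. Poly_Mapping.lookup f s \<odot>\<^bsub>W\<^esub> B s)"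

context complex_linear
begin

text \<open>The supports of two formal sums and of their total differ. Padding with zero terms moves
  all lifts to one index set, where linearity can be checked termwise.\<close>

lemma free_lift_superset:
  assumes "finite A" "Poly_Mapping.keys f \<subseteq> A" "B \<in> A \<rightarrow> carrier V"
  shows "free_lift V B f = (\<Oplus>s\<in>A. Poly_Mapping.lookup f s \<odot> B s)"
  unfolding free_lift_def
  by (rule M.add.finprod_mono_neutral_cong_left) (use assms in \<open>auto simp: in_keys_iff Pi_iff\<close>)

lemma free_lift_closed [simp]:
  "f \<in> carrier (free_module S) \<Longrightarrow> B \<in> S \<rightarrow> carrier V \<Longrightarrow> free_lift V B f \<in> carrier V"
  unfolding free_lift_def by (rule M.finsum_closed) (auto simp: free_module_def)

lemma free_lift_0 [simp]: "free_lift V B 0 = \<zero>"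
  by (simp add: free_lift_def)

lemma free_lift_add:
  assumes "f \<in> carrier (free_module S)" "g \<in> carrier (free_module S)" "B \<in> S \<rightarrow> carrier V"
  shows "free_lift V B (f + g) = free_lift V B f \<oplus> free_lift V B g"
proof -
  let ?A = "Poly_Mapping.keys f \<union> Poly_Mapping.keys g"
  have B: "B \<in> ?A \<rightarrow> carrier V"
    using assms by (auto simp: free_module_def)
  have "free_lift V B (f + g) = (\<Oplus>s\<in>?A. Poly_Mapping.lookup (f + g) s \<odot> B s)"
    using B keys_add[of f g] by (intro free_lift_superset) auto
  also have "\<dots> = (\<Oplus>s\<in>?A. Poly_Mapping.lookup f s \<odot> B s \<oplus> Poly_Mapping.lookup g s \<odot> B s)"
    using B by (intro M.finsum_cong') (auto simp: lookup_add smult_add_left Pi_iff)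
  also have "\<dots> = (\<Oplus>s\<in>?A. Poly_Mapping.lookup f s \<odot> B s) \<oplus> (\<Oplus>s\<in>?A. Poly_Mapping.lookup g s \<odot> B s)"
    using B by (intro M.finsum_addf) auto
  also have "\<dots> = free_lift V B f \<oplus> free_lift V B g"
    using B by (simp add: free_lift_superset[of ?A])
  finally show ?thesis .
qed

lemma free_lift_smult:
  assumes "f \<in> carrier (free_module S)" "B \<in> S \<rightarrow> carrier V"
  shows "free_lift V B (Poly_Mapping.map ((*) c) f) = c \<odot> free_lift V B f"
proof -
  let ?A = "Poly_Mapping.keys f"
  have B: "B \<in> ?A \<rightarrow> carrier V"
    using assms by (auto simp: free_module_def)
  have "free_lift V B (Poly_Mapping.map ((*) c) f) = (\<Oplus>s\<in>?A. Poly_Mapping.lookup (Poly_Mapping.map ((*) c) f) s \<odot> B s)"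
    using B by (intro free_lift_superset) (auto simp: in_keys_iff map.rep_eq when_def)
  also have "\<dots> = (\<Oplus>s\<in>?A. c \<odot> (Poly_Mapping.lookup f s \<odot> B s))"
    using B by (intro M.finsum_cong') (auto simp: map.rep_eq when_def smult_mult Pi_iff in_keys_iff)
  also have "\<dots> = c \<odot> free_lift V B f"
    unfolding free_lift_def using B by (intro finsum_smult_ldistr[symmetric]) auto
  finally show ?thesis .
qed

lemma free_lift_diff:
  assumes "f \<in> carrier (free_module S)" "g \<in> carrier (free_module S)" "B \<in> S \<rightarrow> carrier V"
  shows "free_lift V B (f - g) = free_lift V B f \<ominus> free_lift V B g"
proof -
  interpret F: complex_linear "free_module S"
    by (rule complex_linear_free_module)
  have eq: "- g = Poly_Mapping.map ((*) (- 1)) g"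
    by (rule poly_mapping_eqI) (simp add: map.rep_eq when_def)
  have g: "- g \<in> carrier (free_module S)"
    using assms(2) by (auto simp: free_module_def)
  then show ?thesis
    using free_lift_add[OF assms(1) g assms(3)] free_lift_smult[OF assms(2,3), of "-1"] assms
    by (simp add: a_minus_def minus_eq_smult flip: eq)
qed

lemma free_lift_single [simp]: "B s \<in> carrier V \<Longrightarrow> free_lift V B (Poly_Mapping.single s c) = c \<odot> B s"
  by (cases "c = 0") (simp_all add: free_lift_def)

lemma free_lift_sum:
  fixes n :: nat
  assumes "B \<in> S \<rightarrow> carrier V" "\<And>k. k < n \<Longrightarrow> s k \<in> S"
  shows "free_lift V B (\<Sum>k<n. Poly_Mapping.single (s k) 1) = (\<Oplus>k\<in>{..<n}. B (s k))"
  using assms(2)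
proof (induction n)
  case (Suc n)
  \<comment> \<open>Additivity of the lift asks for membership of the partial sums in the free
    space, hence this separate bound on their supports.\<close>
  have "Poly_Mapping.keys (\<Sum>k<m. Poly_Mapping.single (s k) (1::complex)) \<subseteq> S" if "m \<le> n" for m
    using that
  proof (induction m)
    case (Suc m)
    then show ?case
      using keys_add[of "\<Sum>k<m. Poly_Mapping.single (s k) (1::complex)" "Poly_Mapping.single (s m) 1"] Suc.prems
        \<open>\<And>k. k < Suc n \<Longrightarrow> s k \<in> S\<close>[of m]
      by auto
  qed simp
  then show ?case
    using Suc assms(1) by (subst sum.lessThan_Suc, subst free_lift_add[of _ S])
       (auto simp: free_module_def finsum_lessThan_Suc Pi_iff)
qed simp

end

section \<open>The tensor product of two spaces and its universal property\<close>

locale tensor_pair = U: complex_linear U + V: complex_linear V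
  for U :: "(complex, 'u, 'm) module_scheme" and V :: "(complex, 'v, 'n) module_scheme"
begin

abbreviation "S \<equiv> carrier U \<times> carrier V"
abbreviation "N \<equiv> tensor_relations U V"
abbreviation "e \<equiv> \<lambda>u v. Poly_Mapping.single (u, v) (1 :: complex)"
abbreviation "T \<equiv> tensor U V"

text \<open>Names the generators apart from the hull, so that a property of all relations can be
  checked on the generators alone.\<close>

definition relators :: "('u \<times> 'v \<Rightarrow>\<^sub>0 complex) set" where
  "relators =
     {e (u \<oplus>\<^bsub>U\<^esub> u') v - e u v - e u' v | u u' v. u \<in> carrier U \<and> u' \<in> carrier U \<and> v \<in> carrier V}
   \<union> {e u (v \<oplus>\<^bsub>V\<^esub> v') - e u v - e u v' | u v v'. u \<in> carrier U \<and> v \<in> carrier V \<and> v' \<in> carrier V}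
   \<union> {e (c \<odot>\<^bsub>U\<^esub> u) v - Poly_Mapping.map ((*) c) (e u v) | c u v. u \<in> carrier U \<and> v \<in> carrier V}
   \<union> {e u (c \<odot>\<^bsub>V\<^esub> v) - Poly_Mapping.map ((*) c) (e u v) | c u v. u \<in> carrier U \<and> v \<in> carrier V}"

lemma tensor_relations_eq: "N = (\<lambda>N. submodule N complex_ring (free_module S)) hull relators"
  by (simp add: tensor_relations_def relators_def)

sublocale F: complex_linear "free_module S"
  by (rule complex_linear_free_module)

lemma e_closed [simp]:
  "u \<in> carrier U \<Longrightarrow> v \<in> carrier V \<Longrightarrow> Poly_Mapping.single (u, v) c \<in> carrier (free_module S)"
  by (simp add: free_module_def)

lemma diff_closed [simp]:
  "f \<in> carrier (free_module S) \<Longrightarrow> g \<in> carrier (free_module S) \<Longrightarrow> f - g \<in> carrier (free_module S)"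
  using keys_diff[of f g] by (auto simp: free_module_def)

lemma map_closed [simp]:
  "f \<in> carrier (free_module S) \<Longrightarrow> Poly_Mapping.map ((*) c) f \<in> carrier (free_module S)"
  using F.smult_in_carrier[of f c] by (simp add: free_module_def)

text \<open>The relations are written with the subtraction of the type of polynomial mappings,
  equality of cosets with the one derived from the record. This identifies the two.\<close>

lemma minus_free:
  "f \<in> carrier (free_module S) \<Longrightarrow> g \<in> carrier (free_module S) \<Longrightarrow> f \<ominus>\<^bsub>free_module S\<^esub> g = f - g"
  using F.minus_eq_smult[of g]
  by (auto simp: a_minus_def free_module_def map.rep_eq when_def lookup_add lookup_minus intro!: poly_mapping_eqI)

lemma relators_closed: "relators \<subseteq> carrier (free_module S)"
  by (auto simp: relators_def intro!: diff_closed e_closed)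

text \<open>The hull is the intersection of all submodules containing the generators. The whole free
  space is one of them, which keeps the intersection inside the carrier; the closure properties hold
  in each of them.\<close>

lemma submodule_tensor_relations: "submodule N complex_ring (free_module S)"
proof (rule F.submoduleI)
  have sub: "submodule (carrier (free_module S)) complex_ring (free_module S)"
    by (rule F.carrier_is_submodule)
  show "N \<subseteq> carrier (free_module S)"
    unfolding tensor_relations_eq using sub relators_closed by (intro hull_minimal)
  show "\<zero>\<^bsub>free_module S\<^esub> \<in> N"
    by (auto simp: tensor_relations_eq hull_def submodule_def dest: subgroup.one_closed)
qed (auto simp: tensor_relations_eq hull_def intro: F.submoduleE)

sublocale T: complex_quotient N "free_module S"
  by (intro complex_quotient.intro F.complex_linear_axioms submodule_tensor_relations)

lemma tensor_eq: "T = T.Q"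
  by (simp add: tensor_def)

sublocale T: complex_linear T
  unfolding tensor_eq by (rule T.quotient_linear)

lemma elem_tensor_eq: "elem_tensor U V u v = N +>\<^bsub>free_module S\<^esub> e u v"
  by (simp add: elem_tensor_def)

lemma elem_closed [simp]: "u \<in> carrier U \<Longrightarrow> v \<in> carrier V \<Longrightarrow> elem_tensor U V u v \<in> carrier T"
  by (simp add: elem_tensor_eq tensor_eq T.coset_in_quotient)

lemma
  shows elem_add_left: "u \<in> carrier U \<Longrightarrow> u' \<in> carrier U \<Longrightarrow> v \<in> carrier V \<Longrightarrow>
      elem_tensor U V (u \<oplus>\<^bsub>U\<^esub> u') v = elem_tensor U V u v \<oplus>\<^bsub>T\<^esub> elem_tensor U V u' v"
    and elem_add_right: "u \<in> carrier U \<Longrightarrow> v \<in> carrier V \<Longrightarrow> v' \<in> carrier V \<Longrightarrow>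
      elem_tensor U V u (v \<oplus>\<^bsub>V\<^esub> v') = elem_tensor U V u v \<oplus>\<^bsub>T\<^esub> elem_tensor U V u v'"
    and elem_smult_left: "u \<in> carrier U \<Longrightarrow> v \<in> carrier V \<Longrightarrow>
      elem_tensor U V (c \<odot>\<^bsub>U\<^esub> u) v = c \<odot>\<^bsub>T\<^esub> elem_tensor U V u v"
    and elem_smult_right: "u \<in> carrier U \<Longrightarrow> v \<in> carrier V \<Longrightarrow>
      elem_tensor U V u (c \<odot>\<^bsub>V\<^esub> v) = c \<odot>\<^bsub>T\<^esub> elem_tensor U V u v"
proof -
  have add: "f \<oplus>\<^bsub>free_module S\<^esub> g = f + g" and smult: "c \<odot>\<^bsub>free_module S\<^esub> f = Poly_Mapping.map ((*) c) f"
    for c f g by (simp_all add: free_module_def)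
  have rel: "f \<in> relators \<Longrightarrow> f \<in> N" for f
    unfolding tensor_relations_eq by (rule hull_inc)
  have coset_eq: "N +>\<^bsub>free_module S\<^esub> f = N +>\<^bsub>free_module S\<^esub> g"
    if "f - g \<in> relators" "f \<in> carrier (free_module S)" "g \<in> carrier (free_module S)" for f g
    using that rel by (simp add: T.coset_eq_iff minus_free)
  have add_closed: "f + g \<in> carrier (free_module S)"
    if "f \<in> carrier (free_module S)" "g \<in> carrier (free_module S)" for f g
    using F.a_closed[OF that] by (simp add: add)
  {
    assume *: "u \<in> carrier U" "u' \<in> carrier U" "v \<in> carrier V"
    \<comment> \<open>A relator has the shape \<open>f - g - h\<close>, whereas equality of cosets
      asks for \<open>f - (g + h)\<close>; \<open>diff_diff_eq\<close> bridges the two.\<close>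
    have "e (u \<oplus>\<^bsub>U\<^esub> u') v - (e u v + e u' v) \<in> relators"
      unfolding relators_def diff_diff_eq[symmetric] using * by blast
    with * show "elem_tensor U V (u \<oplus>\<^bsub>U\<^esub> u') v = elem_tensor U V u v \<oplus>\<^bsub>T\<^esub> elem_tensor U V u' v"
      by (simp add: elem_tensor_eq tensor_eq T.quotient_add add) (rule coset_eq; simp add: add_closed)
  next
    assume *: "u \<in> carrier U" "v \<in> carrier V" "v' \<in> carrier V"
    have "e u (v \<oplus>\<^bsub>V\<^esub> v') - (e u v + e u v') \<in> relators"
      unfolding relators_def diff_diff_eq[symmetric] using * by blast
    with * show "elem_tensor U V u (v \<oplus>\<^bsub>V\<^esub> v') = elem_tensor U V u v \<oplus>\<^bsub>T\<^esub> elem_tensor U V u v'"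
      by (simp add: elem_tensor_eq tensor_eq T.quotient_add add) (rule coset_eq; simp add: add_closed)
  next
    assume *: "u \<in> carrier U" "v \<in> carrier V"
    have "e (c \<odot>\<^bsub>U\<^esub> u) v - Poly_Mapping.map ((*) c) (e u v) \<in> relators"
      unfolding relators_def using * by blast
    with * show "elem_tensor U V (c \<odot>\<^bsub>U\<^esub> u) v = c \<odot>\<^bsub>T\<^esub> elem_tensor U V u v"
      unfolding elem_tensor_eq tensor_eq T.quotient_smult[OF e_closed[OF *]] smult
      by (intro coset_eq) simp_all
    have "e u (c \<odot>\<^bsub>V\<^esub> v) - Poly_Mapping.map ((*) c) (e u v) \<in> relators"
      unfolding relators_def using * by blast
    with * show "elem_tensor U V u (c \<odot>\<^bsub>V\<^esub> v) = c \<odot>\<^bsub>T\<^esub> elem_tensor U V u v"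
      unfolding elem_tensor_eq tensor_eq T.quotient_smult[OF e_closed[OF *]] smult
      by (intro coset_eq) simp_all
  }
qed

text \<open>
  The universal property is stated for families that are bilinear only eventually along a filter:
  evaluating chosen representatives of \<open>L\<^sub>p\<close>-classes at \<open>t\<close> is linear only for almost every \<open>t\<close>, with
  an exceptional set that depends on the arguments.
\<close>

lemma eventually_free_lift_zero:
  assumes W: "complex_linear W" and f: "f \<in> N"
    and closed: "\<And>t. B t \<in> S \<rightarrow> carrier W"
    and add_left: "\<And>u u' v. u \<in> carrier U \<Longrightarrow> u' \<in> carrier U \<Longrightarrow> v \<in> carrier V \<Longrightarrow>
      \<forall>\<^sub>F t in F. B t (u \<oplus>\<^bsub>U\<^esub> u', v) = B t (u, v) \<oplus>\<^bsub>W\<^esub> B t (u', v)"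
    and add_right: "\<And>u v v'. u \<in> carrier U \<Longrightarrow> v \<in> carrier V \<Longrightarrow> v' \<in> carrier V \<Longrightarrow>
      \<forall>\<^sub>F t in F. B t (u, v \<oplus>\<^bsub>V\<^esub> v') = B t (u, v) \<oplus>\<^bsub>W\<^esub> B t (u, v')"
    and smult_left: "\<And>c u v. u \<in> carrier U \<Longrightarrow> v \<in> carrier V \<Longrightarrow>
      \<forall>\<^sub>F t in F. B t (c \<odot>\<^bsub>U\<^esub> u, v) = c \<odot>\<^bsub>W\<^esub> B t (u, v)"
    and smult_right: "\<And>c u v. u \<in> carrier U \<Longrightarrow> v \<in> carrier V \<Longrightarrow>
      \<forall>\<^sub>F t in F. B t (u, c \<odot>\<^bsub>V\<^esub> v) = c \<odot>\<^bsub>W\<^esub> B t (u, v)"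
  shows "\<forall>\<^sub>F t in F. free_lift W (B t) f = \<zero>\<^bsub>W\<^esub>"
proof -
  interpret W: complex_linear W by (rule W)
  \<comment> \<open>The exceptional set may depend on \<open>f\<close>, so the eventual statement
    stands inside the comprehension. Two eventual statements combine into one, which makes
    \<open>?K\<close> a submodule; it contains the generators, hence their hull.\<close>
  let ?K = "{f \<in> carrier (free_module S). \<forall>\<^sub>F t in F. free_lift W (B t) f = \<zero>\<^bsub>W\<^esub>}"
  have smult: "c \<odot>\<^bsub>free_module S\<^esub> g = Poly_Mapping.map ((*) c) g"
    and add: "g \<oplus>\<^bsub>free_module S\<^esub> g' = g + g'" for c g g' by (simp_all add: free_module_def)
  have K_smult: "c \<odot>\<^bsub>free_module S\<^esub> g \<in> ?K" if "g \<in> ?K" for c g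
    using that closed by (auto simp: smult W.free_lift_smult elim!: eventually_mono)
  have K: "submodule ?K complex_ring (free_module S)"
  proof (rule F.submoduleI)
    show "\<zero>\<^bsub>free_module S\<^esub> \<in> ?K"
      by (simp add: free_module_def)
    show "\<ominus>\<^bsub>free_module S\<^esub> g \<in> ?K" if "g \<in> ?K" for g
      using K_smult[OF that, of "-1"] that by (simp add: F.minus_eq_smult)
    show "g \<oplus>\<^bsub>free_module S\<^esub> h \<in> ?K" if "g \<in> ?K" "h \<in> ?K" for g h
    proof -
      have "\<forall>\<^sub>F t in F. free_lift W (B t) (g + h) = \<zero>\<^bsub>W\<^esub>"
        using that closed by (auto simp: W.free_lift_add[of _ S] elim: eventually_elim2)
      then show ?thesis
        using that F.a_closed[of g h] by (simp add: add)
    qed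
    show "c \<odot>\<^bsub>free_module S\<^esub> g \<in> ?K" if "g \<in> ?K" for c g
      using that by (rule K_smult)
  qed auto
  have B: "B t (u, v) \<in> carrier W" if "u \<in> carrier U" "v \<in> carrier V" for t u v
    using closed[of t] that by auto
  have "relators \<subseteq> ?K"
  proof
    fix f assume f: "f \<in> relators"
    have "\<forall>\<^sub>F t in F. free_lift W (B t) f = \<zero>\<^bsub>W\<^esub>"
      using f unfolding relators_def
      apply (elim UnE CollectE exE conjE)
      subgoal for u u' v using add_left[of u u' v]
        by (auto simp: W.free_lift_diff[OF _ _ closed] B elim!: eventually_mono)
      subgoal for u v v' using add_right[of u v v']
        by (auto simp: W.free_lift_diff[OF _ _ closed] B elim!: eventually_mono)
      subgoal for c u v using smult_left[of u v c]
        by (auto simp: W.free_lift_diff[OF _ _ closed] B a_minus_def W.r_neg W.free_lift_smult[OF _ closed] simp del: map_single elim!: eventually_mono)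
      subgoal for c u v using smult_right[of u v c]
        by (auto simp: W.free_lift_diff[OF _ _ closed] B a_minus_def W.r_neg W.free_lift_smult[OF _ closed] simp del: map_single elim!: eventually_mono)
      done
    then show "f \<in> ?K"
      using f relators_closed by blast
  qed
  with K have "N \<subseteq> ?K"
    unfolding tensor_relations_eq by (intro hull_minimal)
  with f show ?thesis
    by blast
qed

lemma coset_sum_eq:
  fixes n :: nat
  assumes "\<And>k. k < n \<Longrightarrow> u k \<in> carrier U" "\<And>k. k < n \<Longrightarrow> v k \<in> carrier V"
  shows "(\<Sum>k<n. e (u k) (v k)) \<in> carrier (free_module S)"
    and "(\<Oplus>\<^bsub>T\<^esub>k\<in>{..<n}. elem_tensor U V (u k) (v k)) = N +>\<^bsub>free_module S\<^esub> (\<Sum>k<n. e (u k) (v k))"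
proof -
  \<comment> \<open>The two claims go through one induction because addition of cosets needs the
    representatives to lie in the free space.\<close>
  have "(\<Sum>k<n. e (u k) (v k)) \<in> carrier (free_module S) \<and>
     (\<Oplus>\<^bsub>T\<^esub>k\<in>{..<n}. elem_tensor U V (u k) (v k)) = N +>\<^bsub>free_module S\<^esub> (\<Sum>k<n. e (u k) (v k))"
    using assms
  proof (induction n)
    case 0
    show ?case
    proof
      have zero: "\<zero>\<^bsub>free_module S\<^esub> = 0"
        by (simp add: free_module_def)
      then show "(\<Sum>k<0. e (u k) (v k)) \<in> carrier (free_module S)"
        using F.zero_closed by simp
      have "\<zero>\<^bsub>T\<^esub> = N +>\<^bsub>free_module S\<^esub> 0"
        using T.quotient_zero by (simp add: tensor_eq zero)
      then show "(\<Oplus>\<^bsub>T\<^esub>k\<in>{..<0}. elem_tensor U V (u k) (v k)) = N +>\<^bsub>free_module S\<^esub> (\<Sum>k<0. e (u k) (v k))"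
        by simp
    qed
  next
    case (Suc n)
    have add: "f \<oplus>\<^bsub>free_module S\<^esub> g = f + g" for f g
      by (simp add: free_module_def)
    have IH: "(\<Sum>k<n. e (u k) (v k)) \<in> carrier (free_module S)"
      using Suc by simp
    have "(\<Sum>k<Suc n. e (u k) (v k)) \<in> carrier (free_module S)"
      using F.a_closed[OF IH e_closed, of "u n" "v n"] Suc.prems by (simp add: add)
    moreover have "N +>\<^bsub>free_module S\<^esub> (\<Sum>k<Suc n. e (u k) (v k)) =
        (N +>\<^bsub>free_module S\<^esub> (\<Sum>k<n. e (u k) (v k))) \<oplus>\<^bsub>T\<^esub> (N +>\<^bsub>free_module S\<^esub> e (u n) (v n))"
      using IH Suc.prems by (simp add: tensor_eq T.quotient_add add)
    ultimately show ?case
      using Suc by (simp add: T.finsum_lessThan_Suc flip: elem_tensor_eq)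
  qed
  then show "(\<Sum>k<n. e (u k) (v k)) \<in> carrier (free_module S)"
    and "(\<Oplus>\<^bsub>T\<^esub>k\<in>{..<n}. elem_tensor U V (u k) (v k)) = N +>\<^bsub>free_module S\<^esub> (\<Sum>k<n. e (u k) (v k))"
    by blast+
qed

text \<open>The two representing formal sums differ by an element of the relations, and there the
  lift vanishes eventually. Comparing representations avoids a map on the tensor product, which a
  family that is bilinear only eventually need not induce at any single \<open>t\<close>.\<close>

proposition eventually_bilinear_eq:
  fixes m n :: nat and F :: "'t filter"
  assumes W: "complex_linear W"
    and closed: "\<And>t u v. u \<in> carrier U \<Longrightarrow> v \<in> carrier V \<Longrightarrow> B t u v \<in> carrier W"
    and bilinear:
     "\<And>u u' v. u \<in> carrier U \<Longrightarrow> u' \<in> carrier U \<Longrightarrow> v \<in> carrier V \<Longrightarrow>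
      \<forall>\<^sub>F t in F. B t (u \<oplus>\<^bsub>U\<^esub> u') v = B t u v \<oplus>\<^bsub>W\<^esub> B t u' v"
     "\<And>u v v'. u \<in> carrier U \<Longrightarrow> v \<in> carrier V \<Longrightarrow> v' \<in> carrier V \<Longrightarrow>
      \<forall>\<^sub>F t in F. B t u (v \<oplus>\<^bsub>V\<^esub> v') = B t u v \<oplus>\<^bsub>W\<^esub> B t u v'"
     "\<And>c u v. u \<in> carrier U \<Longrightarrow> v \<in> carrier V \<Longrightarrow> \<forall>\<^sub>F t in F. B t (c \<odot>\<^bsub>U\<^esub> u) v = c \<odot>\<^bsub>W\<^esub> B t u v"
     "\<And>c u v. u \<in> carrier U \<Longrightarrow> v \<in> carrier V \<Longrightarrow> \<forall>\<^sub>F t in F. B t u (c \<odot>\<^bsub>V\<^esub> v) = c \<odot>\<^bsub>W\<^esub> B t u v"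
    and uv: "\<And>k. k < m \<Longrightarrow> u k \<in> carrier U" "\<And>k. k < m \<Longrightarrow> v k \<in> carrier V"
    and uv': "\<And>k. k < n \<Longrightarrow> u' k \<in> carrier U" "\<And>k. k < n \<Longrightarrow> v' k \<in> carrier V"
    and eq: "(\<Oplus>\<^bsub>T\<^esub>k\<in>{..<m}. elem_tensor U V (u k) (v k)) = (\<Oplus>\<^bsub>T\<^esub>k\<in>{..<n}. elem_tensor U V (u' k) (v' k))"
  shows "\<forall>\<^sub>F t in F. (\<Oplus>\<^bsub>W\<^esub>k\<in>{..<m}. B t (u k) (v k)) = (\<Oplus>\<^bsub>W\<^esub>k\<in>{..<n}. B t (u' k) (v' k))"
proof -
  interpret W: complex_linear W by (rule W)
  define f where "f = (\<Sum>k<m. e (u k) (v k))"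
  define g where "g = (\<Sum>k<n. e (u' k) (v' k))"
  have fg: "f \<in> carrier (free_module S)" "g \<in> carrier (free_module S)"
    unfolding f_def g_def using uv uv' by (auto intro!: coset_sum_eq(1))
  have closed': "case_prod (B t) \<in> S \<rightarrow> carrier W" for t
    using closed by auto
  have "f - g \<in> N"
    using eq fg uv uv' coset_sum_eq(2)[of m u v] coset_sum_eq(2)[of n u' v']
    by (simp add: T.coset_eq_iff minus_free f_def g_def)
  then have "\<forall>\<^sub>F t in F. free_lift W (case_prod (B t)) (f - g) = \<zero>\<^bsub>W\<^esub>"
    using closed' bilinear by (intro eventually_free_lift_zero[OF W]) simp_all
  then show ?thesis
  proof eventually_elim
    case (elim t)
    have lift: "free_lift W (case_prod (B t)) f = (\<Oplus>\<^bsub>W\<^esub>k\<in>{..<m}. B t (u k) (v k))"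
        "free_lift W (case_prod (B t)) g = (\<Oplus>\<^bsub>W\<^esub>k\<in>{..<n}. B t (u' k) (v' k))"
      unfolding f_def g_def using uv uv' W.free_lift_sum[OF closed', of _ "\<lambda>k. (u k, v k)"]
        W.free_lift_sum[OF closed', of _ "\<lambda>k. (u' k, v' k)"] by auto
    have c: "free_lift W (case_prod (B t)) f \<in> carrier W" "free_lift W (case_prod (B t)) g \<in> carrier W"
      using fg closed' by (auto intro: W.free_lift_closed)
    have "free_lift W (case_prod (B t)) f \<ominus>\<^bsub>W\<^esub> free_lift W (case_prod (B t)) g = \<zero>\<^bsub>W\<^esub>"
      using elim W.free_lift_diff[OF fg closed'] by simp
    with c show ?case
      by (simp add: lift)
  qed
qed

end

lemma hilbert_module_simps [simp]:
  "carrier hilbert_module = UNIV" "\<xi> \<oplus>\<^bsub>hilbert_module\<^esub> \<eta> = \<xi> + \<eta>"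
  "c \<odot>\<^bsub>hilbert_module\<^esub> \<xi> = c *\<^sub>C \<xi>" "\<zero>\<^bsub>hilbert_module\<^esub> = 0"
  by (simp_all add: hilbert_module_def)

lemma complex_module_simps [simp]:
  "carrier complex_module = UNIV" "x \<oplus>\<^bsub>complex_module\<^esub> y = x + y"
  "c \<odot>\<^bsub>complex_module\<^esub> x = c * x" "\<zero>\<^bsub>complex_module\<^esub> = 0"
  by (simp_all add: complex_module_def)

section \<open>Elementary Hilbert space geometry\<close>

interpretation scaleC: Modules.module "scaleC :: complex \<Rightarrow> 'h::complex_hilbert \<Rightarrow> 'h"
  by unfold_locales (use scaleC_of_real[of 1] in \<open>auto simp: scaleC_add_right scaleC_add_left scaleC_scaleC\<close>)

text \<open>The empty set is finite and spans only zero, so a nonzero vector exists and can be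
  normalised.\<close>

lemma infinite_dimensional_imp_unit_vector:
  assumes "infinite_dimensional TYPE('h::complex_hilbert)"
  shows "\<exists>\<xi>::'h. norm \<xi> = 1"
proof -
  have "scaleC.span {} \<noteq> (UNIV :: 'h set)"
    using assms unfolding infinite_dimensional_def by blast
  then obtain \<xi> :: 'h where "\<xi> \<noteq> 0"
    by auto
  then have "norm (\<xi> /\<^sub>R norm \<xi>) = 1"
    by simp
  then show ?thesis
    by blast
qed

lemma norm_scaleC [simp]: "norm (c *\<^sub>C \<xi>) = cmod c * norm (\<xi> :: 'h::complex_hilbert)"
proof -
  have "complex_of_real ((norm (c *\<^sub>C \<xi>))\<^sup>2) = c * cnj c * complex_of_real ((norm \<xi>)\<^sup>2)"
    by (metis cinner_commute cinner_scaleC_left cinner_self complex_cnj_complex_of_real complex_cnj_mult mult.assoc mult.commute)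
  also have "\<dots> = complex_of_real ((cmod c * norm \<xi>)\<^sup>2)"
    by (simp add: complex_norm_square[symmetric] power_mult_distrib)
  finally show ?thesis
    by (simp only: of_real_eq_iff) (simp add: power2_eq_iff_nonneg)
qed

lemma cinner_minus_left: "cinner (x - y) z = cinner x z - cinner y z"
  using cinner_add_left[of "x - y" y z] by simp

lemma cinner_add_right: "cinner x (y + z) = cinner x y + cinner x z"
  by (metis cinner_commute cinner_add_left complex_cnj_add)

lemma cinner_scaleC_right: "cinner x (c *\<^sub>C y) = cnj c * cinner x y"
  by (metis cinner_commute cinner_scaleC_left complex_cnj_mult)

text \<open>Cauchy-Schwarz against a unit vector, by Pythagoras for the projection of
  \<open>\<zeta>\<close> onto the line of \<open>\<xi>\<close>. It bounds the rank-one operators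
  used for the underlying norm.\<close>

lemma cmod_cinner_unit_le:
  fixes \<xi> \<zeta> :: "'h::complex_hilbert"
  assumes "norm \<xi> = 1"
  shows "cmod (cinner \<zeta> \<xi>) \<le> norm \<zeta>"
proof -
  define c where "c = cinner \<zeta> \<xi>"
  have "cinner (\<zeta> - c *\<^sub>C \<xi>) \<xi> = 0"
    using assms by (simp add: cinner_minus_left cinner_scaleC_left cinner_self c_def)
  then have "cinner (\<zeta> - c *\<^sub>C \<xi>) (c *\<^sub>C \<xi>) = 0" "cinner (c *\<^sub>C \<xi>) (\<zeta> - c *\<^sub>C \<xi>) = 0"
    using cinner_commute[of "c *\<^sub>C \<xi>" "\<zeta> - c *\<^sub>C \<xi>"] by (simp_all add: cinner_scaleC_right)
  then have "cinner \<zeta> \<zeta> = cinner (\<zeta> - c *\<^sub>C \<xi>) (\<zeta> - c *\<^sub>C \<xi>) + cinner (c *\<^sub>C \<xi>) (c *\<^sub>C \<xi>)"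
    using cinner_add_left[of "\<zeta> - c *\<^sub>C \<xi>" "c *\<^sub>C \<xi>" \<zeta>]
      cinner_add_right[of _ "\<zeta> - c *\<^sub>C \<xi>" "c *\<^sub>C \<xi>"] by simp
  then have "(norm \<zeta>)\<^sup>2 = (norm (\<zeta> - c *\<^sub>C \<xi>))\<^sup>2 + (cmod c)\<^sup>2"
    unfolding cinner_self using assms by (simp only: of_real_eq_iff flip: of_real_add) simp
  then have "(cmod c)\<^sup>2 \<le> (norm \<zeta>)\<^sup>2"
    by simp
  then show ?thesis
    unfolding c_def by (rule power2_le_imp_le) simp
qed

section \<open>Tensor products with a Hilbert space\<close>

text \<open>Keeps the tensor calculus apart from the norm axioms, so that it applies to
  \<open>complex_pl\<close> and \<open>Lp_pl\<close> before anything about their norms is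
  known.\<close>

locale pl_linear = complex_linear E
  for E :: "('h::complex_hilbert, 'e) pl_space"
begin

sublocale H: tensor_pair "hilbert_module :: (complex, 'h) module" E
  by (intro tensor_pair.intro complex_linear_hilbert_module complex_linear_axioms)

abbreviation HE :: "(complex, ('h \<times> 'e \<Rightarrow>\<^sub>0 complex) set) module" where
  "HE \<equiv> H_tensor E"
abbreviation el :: "'h \<Rightarrow> 'e \<Rightarrow> ('h \<times> 'e \<Rightarrow>\<^sub>0 complex) set" where
  "el \<equiv> elem_tensor hilbert_module E"

lemma el_closed [simp]: "x \<in> carrier E \<Longrightarrow> el \<xi> x \<in> carrier HE"
  by (rule H.elem_closed) simp_all

lemma
  shows el_add_left: "x \<in> carrier E \<Longrightarrow> el (\<xi> + \<eta>) x = el \<xi> x \<oplus>\<^bsub>HE\<^esub> el \<eta> x"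
    and el_scaleC_left: "x \<in> carrier E \<Longrightarrow> el (c *\<^sub>C \<xi>) x = c \<odot>\<^bsub>HE\<^esub> el \<xi> x"
    and el_add_right: "x \<in> carrier E \<Longrightarrow> y \<in> carrier E \<Longrightarrow> el \<xi> (x \<oplus>\<^bsub>E\<^esub> y) = el \<xi> x \<oplus>\<^bsub>HE\<^esub> el \<xi> y"
    and el_smult_right: "x \<in> carrier E \<Longrightarrow> el \<xi> (c \<odot>\<^bsub>E\<^esub> x) = c \<odot>\<^bsub>HE\<^esub> el \<xi> x"
  using H.elem_add_left[of \<xi> \<eta> x] H.elem_smult_left[of \<xi> x c] H.elem_add_right[of \<xi> x y]
    H.elem_smult_right[of \<xi> x c] by simp_all

lemma el_zero_left [simp]: "x \<in> carrier E \<Longrightarrow> el 0 x = \<zero>\<^bsub>HE\<^esub>"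
  using el_scaleC_left[of x 0 0] by simp

lemma el_diff_right:
  assumes "x \<in> carrier E" "y \<in> carrier E"
  shows "el \<xi> (x \<ominus>\<^bsub>E\<^esub> y) = el \<xi> x \<ominus>\<^bsub>HE\<^esub> el \<xi> y"
  using assms by (simp add: a_minus_def minus_eq_smult H.T.minus_eq_smult el_add_right el_smult_right)

lemma tensor_sum_0 [simp]: "tensor_sum E 0 \<xi> x = \<zero>\<^bsub>HE\<^esub>"
  by (simp add: tensor_sum_def)

lemma tensor_sum_Suc:
  "(\<And>k. k < Suc n \<Longrightarrow> x k \<in> carrier E) \<Longrightarrow>
    tensor_sum E (Suc n) \<xi> x = tensor_sum E n \<xi> x \<oplus>\<^bsub>HE\<^esub> el (\<xi> n) (x n)"
  unfolding tensor_sum_def by (rule H.T.finsum_lessThan_Suc) simp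

lemma tensor_sum_closed [simp]:
  "(\<And>k. k < n \<Longrightarrow> x k \<in> carrier E) \<Longrightarrow> tensor_sum E n \<xi> x \<in> carrier HE"
  unfolding tensor_sum_def by (rule H.T.finsum_closed) auto

lemma tensor_sum_cong:
  fixes \<xi> \<eta> :: "nat \<Rightarrow> 'h"
  assumes "\<And>k. k < n \<Longrightarrow> \<xi> k = \<eta> k" "\<And>k. k < n \<Longrightarrow> x k = y k" "\<And>k. k < n \<Longrightarrow> y k \<in> carrier E"
  shows "tensor_sum E n \<xi> x = tensor_sum E n \<eta> y"
  unfolding tensor_sum_def by (rule H.T.finsum_cong') (use assms in auto)

lemma tensor_sum_add_left:
  assumes "\<And>k. k < n \<Longrightarrow> x k \<in> carrier E"
  shows "tensor_sum E n (\<lambda>k. \<xi> k + \<eta> k) x = tensor_sum E n \<xi> x \<oplus>\<^bsub>HE\<^esub> tensor_sum E n \<eta> x"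
proof -
  have "tensor_sum E n (\<lambda>k. \<xi> k + \<eta> k) x = (\<Oplus>\<^bsub>HE\<^esub>k\<in>{..<n}. el (\<xi> k) (x k) \<oplus>\<^bsub>HE\<^esub> el (\<eta> k) (x k))"
    unfolding tensor_sum_def by (rule H.T.finsum_cong') (use assms in \<open>auto simp: el_add_left\<close>)
  also have "\<dots> = tensor_sum E n \<xi> x \<oplus>\<^bsub>HE\<^esub> tensor_sum E n \<eta> x"
    unfolding tensor_sum_def by (rule H.T.finsum_addf) (use assms in auto)
  finally show ?thesis .
qed

lemma tensor_sum_add_right:
  fixes \<xi> :: "nat \<Rightarrow> 'h"
  assumes "\<And>k. k < n \<Longrightarrow> x k \<in> carrier E" "\<And>k. k < n \<Longrightarrow> y k \<in> carrier E"
  shows "tensor_sum E n \<xi> (\<lambda>k. x k \<oplus>\<^bsub>E\<^esub> y k) = tensor_sum E n \<xi> x \<oplus>\<^bsub>HE\<^esub> tensor_sum E n \<xi> y"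
proof -
  have "tensor_sum E n \<xi> (\<lambda>k. x k \<oplus>\<^bsub>E\<^esub> y k) = (\<Oplus>\<^bsub>HE\<^esub>k\<in>{..<n}. el (\<xi> k) (x k) \<oplus>\<^bsub>HE\<^esub> el (\<xi> k) (y k))"
    unfolding tensor_sum_def by (rule H.T.finsum_cong') (use assms in \<open>auto simp: el_add_right\<close>)
  also have "\<dots> = tensor_sum E n \<xi> x \<oplus>\<^bsub>HE\<^esub> tensor_sum E n \<xi> y"
    unfolding tensor_sum_def by (rule H.T.finsum_addf) (use assms in auto)
  finally show ?thesis .
qed

lemma
  fixes \<xi> :: "nat \<Rightarrow> 'h"
  assumes "\<And>k. k < n \<Longrightarrow> x k \<in> carrier E"
  shows tensor_sum_scaleC_left: "tensor_sum E n (\<lambda>k. c *\<^sub>C \<xi> k) x = c \<odot>\<^bsub>HE\<^esub> tensor_sum E n \<xi> x"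
    and tensor_sum_smult_right: "tensor_sum E n \<xi> (\<lambda>k. c \<odot>\<^bsub>E\<^esub> x k) = c \<odot>\<^bsub>HE\<^esub> tensor_sum E n \<xi> x"
proof -
  have smult: "c \<odot>\<^bsub>HE\<^esub> tensor_sum E n \<xi> x = (\<Oplus>\<^bsub>HE\<^esub>k\<in>{..<n}. c \<odot>\<^bsub>HE\<^esub> el (\<xi> k) (x k))"
    unfolding tensor_sum_def by (rule H.T.finsum_smult_ldistr) (use assms in auto)
  show "tensor_sum E n (\<lambda>k. c *\<^sub>C \<xi> k) x = c \<odot>\<^bsub>HE\<^esub> tensor_sum E n \<xi> x"
    unfolding smult unfolding tensor_sum_def
    by (rule H.T.finsum_cong') (use assms in \<open>auto simp: el_scaleC_left\<close>)
  show "tensor_sum E n \<xi> (\<lambda>k. c \<odot>\<^bsub>E\<^esub> x k) = c \<odot>\<^bsub>HE\<^esub> tensor_sum E n \<xi> x"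
    unfolding smult unfolding tensor_sum_def
    by (rule H.T.finsum_cong') (use assms in \<open>auto simp: el_smult_right\<close>)
qed

text \<open>Lets an outer sum be absorbed into the Hilbert factors when all inner sums share the
  same vectors \<open>x\<close>.\<close>

lemma tensor_sum_sum_left:
  fixes m :: nat
  assumes "\<And>k. k < n \<Longrightarrow> x k \<in> carrier E"
  shows "tensor_sum E n (\<lambda>k. \<Sum>i<m. \<xi> i k) x = (\<Oplus>\<^bsub>HE\<^esub>i\<in>{..<m}. tensor_sum E n (\<xi> i) x)"
proof (induction m)
  case 0
  have "tensor_sum E n (\<lambda>k. 0) x = (\<Oplus>\<^bsub>HE\<^esub>k\<in>{..<n}. \<zero>\<^bsub>HE\<^esub>)"
    unfolding tensor_sum_def using assms by (intro H.T.finsum_cong') auto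
  then show ?case
    by simp
next
  case (Suc m)
  then show ?case
    using assms by (simp add: tensor_sum_add_left H.T.finsum_lessThan_Suc)
qed

lemma tensor_sum_mult:
  fixes m n :: nat
  assumes "\<And>i k. i < m \<Longrightarrow> k < n \<Longrightarrow> x i k \<in> carrier E"
  shows "(\<Oplus>\<^bsub>HE\<^esub>i\<in>{..<m}. tensor_sum E n (\<xi> i) (x i)) =
    tensor_sum E (m * n) (\<lambda>l. \<xi> (l div n) (l mod n)) (\<lambda>l. x (l div n) (l mod n))"
  unfolding tensor_sum_def
  by (rule H.T.finsum_lessThan_mult[symmetric]) (simp add: assms)

text \<open>Induction on the support of a formal sum. The coefficient of each new term is absorbed
  into its Hilbert vector, so sums of elementary tensors without coefficients reach
  everything.\<close>

lemma tensor_sum_exhaust: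
  assumes "u \<in> carrier HE"
  obtains n \<xi> x where "\<And>k. k < n \<Longrightarrow> x k \<in> carrier E" "u = tensor_sum E n \<xi> x"
proof -
  let ?F = "free_module (carrier (hilbert_module :: (complex, 'h) module) \<times> carrier E)"
  have "\<exists>n \<xi> x. (\<forall>k<n. x k \<in> carrier E) \<and> H.N +>\<^bsub>?F\<^esub> f = tensor_sum E n \<xi> x" if "f \<in> carrier ?F" for f
    using that
  proof (induction f rule: Poly_Mapping.update_induct)
    case const
    have "H.N +>\<^bsub>?F\<^esub> 0 = \<zero>\<^bsub>HE\<^esub>"
      using H.T.quotient_zero by (simp add: H.tensor_eq) (simp add: free_module_def)
    then show ?case
      by (intro exI[of _ 0]) simp
  next
    case (update f a b)
    obtain \<eta> y where a: "a = (\<eta>, y)"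
      by (cases a)
    have keys: "Poly_Mapping.keys (Poly_Mapping.update a b f) = insert a (Poly_Mapping.keys f)"
      using update by (auto simp: keys_update)
    have f: "f \<in> carrier ?F" and y: "y \<in> carrier E"
      using update.prems keys a by (auto simp: free_module_def)
    \<comment> \<open>The key \<open>a\<close> is new in this induction, so the update amounts to
      adding a multiple of a basis vector.\<close>
    have "Poly_Mapping.update a b f = f \<oplus>\<^bsub>?F\<^esub> (b \<odot>\<^bsub>?F\<^esub> H.e \<eta> y)"
      using update.hyps a
      by (intro poly_mapping_eqI) (auto simp: free_module_def lookup_update lookup_add lookup_single when_def in_keys_iff)
    moreover have "el (b *\<^sub>C \<eta>) y = H.N +>\<^bsub>?F\<^esub> (b \<odot>\<^bsub>?F\<^esub> H.e \<eta> y)"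
    proof -
      have "el (b *\<^sub>C \<eta>) y = b \<odot>\<^bsub>HE\<^esub> el \<eta> y"
        by (rule el_scaleC_left[OF y])
      also have "\<dots> = H.N +>\<^bsub>?F\<^esub> (b \<odot>\<^bsub>?F\<^esub> H.e \<eta> y)"
        unfolding H.elem_tensor_eq H.tensor_eq by (intro H.T.quotient_smult H.e_closed) (use y in auto)
      finally show ?thesis .
    qed
    moreover have "b \<odot>\<^bsub>?F\<^esub> H.e \<eta> y \<in> carrier ?F"
      by (intro H.F.smult_in_carrier H.e_closed) (use y in auto)
    ultimately have eq: "H.N +>\<^bsub>?F\<^esub> Poly_Mapping.update a b f = (H.N +>\<^bsub>?F\<^esub> f) \<oplus>\<^bsub>HE\<^esub> el (b *\<^sub>C \<eta>) y"
      using H.T.quotient_add[OF f, of "b \<odot>\<^bsub>?F\<^esub> H.e \<eta> y"] unfolding H.tensor_eq by simp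
    obtain n \<xi> x where *: "\<forall>k<n. x k \<in> carrier E" "H.N +>\<^bsub>?F\<^esub> f = tensor_sum E n \<xi> x"
      using update.IH f by blast
    have "tensor_sum E (Suc n) (\<xi>(n := b *\<^sub>C \<eta>)) (x(n := y)) = tensor_sum E n (\<xi>(n := b *\<^sub>C \<eta>)) (x(n := y)) \<oplus>\<^bsub>HE\<^esub> el (b *\<^sub>C \<eta>) y"
      using * y by (subst tensor_sum_Suc) (auto simp: less_Suc_eq)
    also have "tensor_sum E n (\<xi>(n := b *\<^sub>C \<eta>)) (x(n := y)) = tensor_sum E n \<xi> x"
      using * by (intro tensor_sum_cong) auto
    finally show ?case
      using * y eq by (intro exI[of _ "Suc n"] exI[of _ "\<xi>(n := b *\<^sub>C \<eta>)"] exI[of _ "x(n := y)"]) (auto simp: less_Suc_eq)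
  qed
  moreover obtain f where "f \<in> carrier ?F" "u = H.N +>\<^bsub>?F\<^esub> f"
    using assms unfolding H.tensor_eq H.T.carrier_quotient by blast
  ultimately show ?thesis
    using that by blast
qed

proposition tensor_sum_eq_eventually_lift:
  fixes F :: "'t filter" and B :: "'t \<Rightarrow> 'h \<Rightarrow> 'e \<Rightarrow> 'w"
  assumes W: "complex_linear W"
    and closed: "\<And>t \<xi> x. x \<in> carrier E \<Longrightarrow> B t \<xi> x \<in> carrier W"
    and bilinear:
     "\<And>\<xi> \<eta> x. x \<in> carrier E \<Longrightarrow> \<forall>\<^sub>F t in F. B t (\<xi> + \<eta>) x = B t \<xi> x \<oplus>\<^bsub>W\<^esub> B t \<eta> x"
     "\<And>\<xi> x y. x \<in> carrier E \<Longrightarrow> y \<in> carrier E \<Longrightarrow>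
        \<forall>\<^sub>F t in F. B t \<xi> (x \<oplus>\<^bsub>E\<^esub> y) = B t \<xi> x \<oplus>\<^bsub>W\<^esub> B t \<xi> y"
     "\<And>c \<xi> x. x \<in> carrier E \<Longrightarrow> \<forall>\<^sub>F t in F. B t (c *\<^sub>C \<xi>) x = c \<odot>\<^bsub>W\<^esub> B t \<xi> x"
     "\<And>c \<xi> x. x \<in> carrier E \<Longrightarrow> \<forall>\<^sub>F t in F. B t \<xi> (c \<odot>\<^bsub>E\<^esub> x) = c \<odot>\<^bsub>W\<^esub> B t \<xi> x"
    and "\<And>k. k < m \<Longrightarrow> x k \<in> carrier E" "\<And>k. k < n \<Longrightarrow> y k \<in> carrier E"
    and "tensor_sum E m \<xi> x = tensor_sum E n \<eta> y"
  shows "\<forall>\<^sub>F t in F. (\<Oplus>\<^bsub>W\<^esub>k\<in>{..<m}. B t (\<xi> k) (x k)) = (\<Oplus>\<^bsub>W\<^esub>k\<in>{..<n}. B t (\<eta> k) (y k))"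
  by (rule H.eventually_bilinear_eq[OF W]) (use assms in \<open>simp_all add: tensor_sum_def\<close>)

corollary tensor_sum_eq_lift:
  fixes B :: "'h \<Rightarrow> 'e \<Rightarrow> 'w"
  assumes W: "complex_linear W"
    and closed: "\<And>\<xi> x. x \<in> carrier E \<Longrightarrow> B \<xi> x \<in> carrier W"
    and bilinear:
     "\<And>\<xi> \<eta> x. x \<in> carrier E \<Longrightarrow> B (\<xi> + \<eta>) x = B \<xi> x \<oplus>\<^bsub>W\<^esub> B \<eta> x"
     "\<And>\<xi> x y. x \<in> carrier E \<Longrightarrow> y \<in> carrier E \<Longrightarrow> B \<xi> (x \<oplus>\<^bsub>E\<^esub> y) = B \<xi> x \<oplus>\<^bsub>W\<^esub> B \<xi> y"
     "\<And>c \<xi> x. x \<in> carrier E \<Longrightarrow> B (c *\<^sub>C \<xi>) x = c \<odot>\<^bsub>W\<^esub> B \<xi> x"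
     "\<And>c \<xi> x. x \<in> carrier E \<Longrightarrow> B \<xi> (c \<odot>\<^bsub>E\<^esub> x) = c \<odot>\<^bsub>W\<^esub> B \<xi> x"
    and "\<And>k. k < m \<Longrightarrow> x k \<in> carrier E" "\<And>k. k < n \<Longrightarrow> y k \<in> carrier E"
    and "tensor_sum E m \<xi> x = tensor_sum E n \<eta> y"
  shows "(\<Oplus>\<^bsub>W\<^esub>k\<in>{..<m}. B (\<xi> k) (x k)) = (\<Oplus>\<^bsub>W\<^esub>k\<in>{..<n}. B (\<eta> k) (y k))"
  \<comment> \<open>For a constant family along \<open>principal UNIV\<close> on the one-point type,
    holding eventually is the same as holding.\<close>
  using tensor_sum_eq_eventually_lift[OF W, of "\<lambda>_::unit. B" "principal UNIV :: unit filter" m x n y \<xi> \<eta>] assms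
  by simp

text \<open>The description has a unique value because
  \<open>\<lambda>\<xi> x. el (a \<xi>) x\<close> is bilinear for linear \<open>a\<close>.\<close>

lemma H_action_tensor_sum:
  fixes a :: "'h \<Rightarrow> 'h"
  assumes a: "clinear_map a" and x: "\<And>k. k < n \<Longrightarrow> x k \<in> carrier E"
  shows "H_action E a (tensor_sum E n \<xi> x) = tensor_sum E n (\<lambda>k. a (\<xi> k)) x"
  unfolding H_action_def
proof (rule the_equality)
  show "\<exists>m \<eta> y. (\<forall>k<m. y k \<in> carrier E) \<and> tensor_sum E n \<xi> x = tensor_sum E m \<eta> y
      \<and> tensor_sum E n (\<lambda>k. a (\<xi> k)) x = tensor_sum E m (\<lambda>k. a (\<eta> k)) y"
    using x by blast
  fix w assume "\<exists>m \<eta> y. (\<forall>k<m. y k \<in> carrier E) \<and> tensor_sum E n \<xi> x = tensor_sum E m \<eta> y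
      \<and> w = tensor_sum E m (\<lambda>k. a (\<eta> k)) y"
  then obtain m \<eta> y where y: "\<And>k. k < m \<Longrightarrow> y k \<in> carrier E"
    and eq: "tensor_sum E n \<xi> x = tensor_sum E m \<eta> y" and w: "w = tensor_sum E m (\<lambda>k. a (\<eta> k)) y"
    by auto
  show "w = tensor_sum E n (\<lambda>k. a (\<xi> k)) x"
    unfolding w tensor_sum_def
    using tensor_sum_eq_lift[OF H.T.complex_linear_axioms _ _ _ _ _ y x eq[symmetric], of "\<lambda>\<xi> x. el (a \<xi>) x"] a
    by (simp add: clinear_map_def el_add_left el_add_right el_scaleC_left el_smult_right)
qed

end

section \<open>Normed spaces and normed PL-spaces\<close>

locale complex_normed = complex_linear V for V :: "(complex, 'v, 'm) module_scheme" (structure) +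
  fixes N :: "'v \<Rightarrow> real"
  assumes is_norm: "is_norm V N"
begin

lemma
  shows norm_nonneg [simp]: "x \<in> carrier V \<Longrightarrow> 0 \<le> N x"
    and norm_eq_zero: "x \<in> carrier V \<Longrightarrow> N x = 0 \<longleftrightarrow> x = \<zero>"
    and norm_triangle: "x \<in> carrier V \<Longrightarrow> y \<in> carrier V \<Longrightarrow> N (x \<oplus> y) \<le> N x + N y"
    and norm_smult: "x \<in> carrier V \<Longrightarrow> N (c \<odot> x) = cmod c * N x"
  using is_norm by (auto simp: is_norm_def)

lemma norm_zero [simp]: "N \<zero> = 0"
  by (simp add: norm_eq_zero)

lemma norm_minus_commute: "x \<in> carrier V \<Longrightarrow> y \<in> carrier V \<Longrightarrow> N (x \<ominus> y) = N (y \<ominus> x)"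
  using norm_smult[of "x \<ominus> y" "-1"] M.a_comm[of x] by (simp add: a_minus_def minus_eq_smult smult_add_right flip: smult_mult)

lemma norm_triangle_sub:
  assumes "x \<in> carrier V" "y \<in> carrier V"
  shows "\<bar>N x - N y\<bar> \<le> N (x \<ominus> y)"
proof -
  have "N x \<le> N y + N (x \<ominus> y)" if "x \<in> carrier V" "y \<in> carrier V" for x y
  proof -
    have "x = y \<oplus> (x \<ominus> y)"
      using that by (simp add: a_minus_def M.a_ac) (metis M.a_assoc M.a_inv_closed M.a_comm M.r_neg M.r_zero)
    then show ?thesis
      using norm_triangle[of y "x \<ominus> y"] that by simp
  qed
  from this[OF assms] this[OF assms(2,1)] show ?thesis
    using norm_minus_commute[OF assms] by simp
qed

end

locale pl_normed =
  fixes E :: "('h::complex_hilbert, 'e) pl_space"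
  assumes normed: "normed_pl_space E" and unit_vector: "\<exists>\<xi>::'h. norm \<xi> = 1"
begin

sublocale pl_linear E
  using normed by (simp add: pl_linear_def complex_linear_def normed_pl_space_def)

sublocale P: complex_normed HE "pl_norm E"
  using normed H.T.complex_linear_axioms
  by (simp add: complex_normed_def complex_normed_axioms_def normed_pl_space_def)

text \<open>The PL axiom in terms of representations. Both of its uses pass through here: rank-one
  operators, and \<open>\<eta> \<mapsto> \<zeta> \<diamond> \<eta>\<close>.\<close>

lemma pl_norm_tensor_sum_le:
  assumes "clinear_map a" "bounded_linear a" "\<And>k. k < n \<Longrightarrow> x k \<in> carrier E"
  shows "pl_norm E (tensor_sum E n (\<lambda>k. a (\<xi> k)) x) \<le> onorm a * pl_norm E (tensor_sum E n \<xi> x)"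
proof -
  have "H_action E a (tensor_sum E n \<xi> x) = tensor_sum E n (\<lambda>k. a (\<xi> k)) x"
    using assms by (intro H_action_tensor_sum)
  moreover have "tensor_sum E n \<xi> x \<in> carrier HE"
    using assms by simp
  ultimately show ?thesis
    using normed assms(1,2) unfolding normed_pl_space_def by metis
qed

text \<open>The rank-one operator \<open>a\<close> below carries \<open>\<xi>\<close> to
  \<open>\<eta>\<close> and has norm at most 1. Exchanging the two vectors gives equality, so the
  underlying norm is well defined.\<close>

lemma pl_norm_elem_unit_le:
  assumes "norm \<xi> = 1" "norm \<eta> = 1" "x \<in> carrier E"
  shows "pl_norm E (el \<eta> x) \<le> pl_norm E (el \<xi> x)"
proof -
  define a where "a = (\<lambda>\<zeta>. cinner \<zeta> \<xi> *\<^sub>C \<eta>)"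
  have a: "clinear_map a"
    by (simp add: clinear_map_def a_def cinner_add_left scaleC_add_left cinner_scaleC_left scaleC_scaleC)
  have le: "norm (a \<zeta>) \<le> norm \<zeta>" for \<zeta>
    using cmod_cinner_unit_le[OF assms(1), of \<zeta>] assms(2) by (simp add: a_def)
  have "bounded_linear a"
    by (rule bounded_linear_intro[of _ 1])
      (use a le in \<open>auto simp: clinear_map_def simp flip: scaleC_of_real\<close>)
  moreover have "onorm a \<le> 1"
    by (rule onorm_bound) (simp_all add: le)
  moreover have "a \<xi> = \<eta>"
    using assms scaleC_of_real[of 1 \<eta>] by (simp add: a_def cinner_self)
  ultimately have "pl_norm E (tensor_sum E 1 (\<lambda>_. \<eta>) (\<lambda>_. x)) \<le> onorm a * pl_norm E (tensor_sum E 1 (\<lambda>_. \<xi>) (\<lambda>_. x))"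
    using pl_norm_tensor_sum_le[OF a, of 1 "\<lambda>_. x" "\<lambda>_. \<xi>"] assms(3) by simp
  also have "\<dots> \<le> 1 * pl_norm E (tensor_sum E 1 (\<lambda>_. \<xi>) (\<lambda>_. x))"
    using \<open>onorm a \<le> 1\<close> assms(3) by (intro mult_right_mono) auto
  finally show ?thesis
    using assms(3) by (simp add: tensor_sum_Suc)
qed

abbreviation "nrm \<equiv> underlying_norm E"

lemma underlying_norm_eq:
  assumes "norm \<xi> = 1" "x \<in> carrier E"
  shows "nrm x = pl_norm E (el \<xi> x)"
  unfolding underlying_norm_def
proof (rule the_equality)
  show "\<forall>\<eta>. norm \<eta> = 1 \<longrightarrow> pl_norm E (el \<eta> x) = pl_norm E (el \<xi> x)"
    using pl_norm_elem_unit_le assms by (meson order_antisym)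
qed (use assms in blast)

lemma pl_norm_elem:
  assumes "x \<in> carrier E"
  shows "pl_norm E (el \<xi> x) = norm \<xi> * nrm x"
proof (cases "\<xi> = 0")
  case True
  then show ?thesis
    using assms by simp
next
  case False
  let ?\<eta> = "\<xi> /\<^sub>R norm \<xi>"
  have "\<xi> = complex_of_real (norm \<xi>) *\<^sub>C ?\<eta>"
    using False by (simp add: scaleC_of_real)
  then have "pl_norm E (el \<xi> x) = norm \<xi> * pl_norm E (el ?\<eta> x)"
    using el_scaleC_left[OF assms, of "complex_of_real (norm \<xi>)" ?\<eta>] P.norm_smult[of "el ?\<eta> x" "complex_of_real (norm \<xi>)"] assms
    by simp
  then show ?thesis
    using underlying_norm_eq[of ?\<eta> x] False assms by simp
qed

text \<open>Contracting the Hilbert factor with \<open>\<xi>\<close> is bilinear and takes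
  \<open>el \<xi> x\<close> back to \<open>x\<close>, while the zero tensor is an empty sum. This
  gives definiteness of the underlying norm.\<close>

lemma el_eq_zero:
  assumes "norm \<xi> = 1" "x \<in> carrier E" "el \<xi> x = \<zero>\<^bsub>HE\<^esub>"
  shows "x = \<zero>\<^bsub>E\<^esub>"
proof -
  have "(\<Oplus>\<^bsub>E\<^esub>k\<in>{..<1::nat}. cinner \<xi> \<xi> \<odot>\<^bsub>E\<^esub> x) = (\<Oplus>\<^bsub>E\<^esub>k\<in>{..<0::nat}. cinner \<xi> \<xi> \<odot>\<^bsub>E\<^esub> x)"
    using assms
    by (intro tensor_sum_eq_lift[where B = "\<lambda>\<eta> y. cinner \<eta> \<xi> \<odot>\<^bsub>E\<^esub> y", OF complex_linear_axioms])
      (auto simp: cinner_add_left smult_add_left smult_add_right cinner_scaleC_left tensor_sum_Suc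
        mult.commute simp flip: smult_mult)
  then show ?thesis
    using assms finsum_lessThan_Suc[of 0 "\<lambda>_. x"] by (simp add: cinner_self)
qed

sublocale complex_normed E nrm
proof
  obtain \<xi> :: 'h where \<xi>: "norm \<xi> = 1"
    using unit_vector by blast
  have "nrm x = 0 \<longleftrightarrow> x = \<zero>\<^bsub>E\<^esub>" if "x \<in> carrier E" for x
    using el_eq_zero[OF \<xi> that] P.norm_eq_zero[of "el \<xi> x"] that pl_norm_elem[of "\<zero>\<^bsub>E\<^esub>" \<xi>]
      el_smult_right[of x \<xi> 0]
    by (auto simp: underlying_norm_eq[OF \<xi>])
  then show "is_norm E nrm"
    by (auto simp: is_norm_def underlying_norm_eq[OF \<xi>] el_add_right el_smult_right P.norm_triangle P.norm_smult)
qed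

end

section \<open>Adjoining a PL-norm to a linear space\<close>

lemma extend_pl_simps [simp]:
  "carrier (module.extend V (pl_space.fields f)) = carrier V"
  "\<zero>\<^bsub>module.extend V (pl_space.fields f)\<^esub> = \<zero>\<^bsub>V\<^esub>"
  "x \<oplus>\<^bsub>module.extend V (pl_space.fields f)\<^esub> y = x \<oplus>\<^bsub>V\<^esub> y"
  "c \<odot>\<^bsub>module.extend V (pl_space.fields f)\<^esub> x = c \<odot>\<^bsub>V\<^esub> x"
  by (simp_all add: module.defs pl_space.defs)

lemma pl_norm_extend [simp]: "pl_norm (module.extend V (pl_space.fields f)) = f"
  by (simp add: module.defs pl_space.defs)

text \<open>A tensor product sees only the linear structure. The definitions of
  \<open>complex_pl\<close> and \<open>Lp_pl\<close> form tensor sums over the bare space; these may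
  now be read over the PL-space.\<close>

lemma tensor_extend_pl [simp]:
  "tensor U (module.extend V (pl_space.fields f)) = tensor U V"
  "elem_tensor U (module.extend V (pl_space.fields f)) = elem_tensor U V"
  "tensor_sum (module.extend V (pl_space.fields f)) = tensor_sum V"
proof -
  have rel: "tensor_relations U (module.extend V (pl_space.fields f)) = tensor_relations U V" for U
    by (simp add: tensor_relations_def)
  show T: "tensor U (module.extend V (pl_space.fields f)) = tensor U V" for U
    by (simp add: tensor_def rel)
  show e: "elem_tensor U (module.extend V (pl_space.fields f)) = elem_tensor U V" for U
    by (intro ext) (simp add: elem_tensor_def rel)
  show "tensor_sum (module.extend V (pl_space.fields f)) = tensor_sum V"
    by (intro ext) (simp add: tensor_sum_def T e)
qed

lemma complex_linear_extend_pl: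
  assumes "complex_linear V"
  shows "complex_linear (module.extend V (pl_space.fields f))"
proof -
  interpret complex_linear V
    by fact
  show ?thesis
  proof (rule complex_linearI)
    show "abelian_group (module.extend V (pl_space.fields f))"
      by (rule abelian_groupI) (auto simp: M.a_ac intro: bexI[of _ "\<ominus>\<^bsub>V\<^esub> x" for x] M.l_neg)
  qed (simp_all add: smult_add_left smult_add_right smult_mult)
qed

section \<open>The scalars as a PL-space\<close>

lemma finsum_hilbert_module [simp]:
  fixes n :: nat
  shows "(\<Oplus>\<^bsub>hilbert_module\<^esub>k\<in>{..<n}. f k) = (\<Sum>k<n. f k)"
proof -
  interpret complex_linear hilbert_module
    by (rule complex_linear_hilbert_module)
  show ?thesis
    by (induction n) (simp_all add: finsum_lessThan_Suc)
qed

interpretation CC: pl_linear complex_pl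
  by (simp add: pl_linear_def complex_pl_def complex_linear_extend_pl complex_linear_complex_module)

lemma complex_pl_simps [simp]:
  "carrier complex_pl = UNIV" "x \<oplus>\<^bsub>complex_pl\<^esub> y = x + y" "c \<odot>\<^bsub>complex_pl\<^esub> x = c * x"
  "\<zero>\<^bsub>complex_pl\<^esub> = 0"
  by (simp_all add: complex_pl_def)

lemma minus_complex_pl [simp]: "x \<ominus>\<^bsub>complex_pl\<^esub> y = x - y"
  using CC.minus_eq_smult[of y] by (simp add: a_minus_def)

text \<open>The bilinear map \<open>\<lambda>\<xi> c. c *\<^sub>C \<xi>\<close> identifies the
  tensor product with \<open>H\<close> itself, so the vector inside the norm does not depend on the
  representation.\<close>

lemma complex_pl_norm:
  fixes \<xi> :: "nat \<Rightarrow> 'h::complex_hilbert"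
  shows "pl_norm complex_pl (tensor_sum (complex_pl :: ('h, complex) pl_space) n \<xi> c) = norm (\<Sum>k<n. c k *\<^sub>C \<xi> k)"
proof -
  let ?C = "complex_pl :: ('h, complex) pl_space"
  have ts: "tensor_sum complex_module n \<eta> d = tensor_sum ?C n \<eta> d" for n d and \<eta> :: "nat \<Rightarrow> 'h"
    by (simp add: complex_pl_def)
  have "(\<Sum>k<m. d k *\<^sub>C \<eta> k) = (\<Sum>k<n. c k *\<^sub>C \<xi> k)"
    if "tensor_sum ?C m \<eta> d = tensor_sum ?C n \<xi> c" for m d and \<eta> :: "nat \<Rightarrow> 'h"
    using CC.tensor_sum_eq_lift[OF complex_linear_hilbert_module _ _ _ _ _ _ _ that, of "\<lambda>\<xi> c. c *\<^sub>C \<xi>"]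
    by (simp add: scaleC_add_right scaleC_add_left scaleC_scaleC mult.commute)
  then have unique: "r = norm (\<Sum>k<n. c k *\<^sub>C \<xi> k)"
    if "tensor_sum ?C n \<xi> c = tensor_sum ?C m \<eta> d" "r = norm (\<Sum>k<m. d k *\<^sub>C \<eta> k)"
    for r m d and \<eta> :: "nat \<Rightarrow> 'h"
    using that by metis
  have "(THE r. \<exists>m \<eta> d. tensor_sum ?C n \<xi> c = tensor_sum ?C m \<eta> d \<and>
      r = norm (\<Sum>k<m. d k *\<^sub>C \<eta> k)) = norm (\<Sum>k<n. c k *\<^sub>C \<xi> k)"
    by (rule the_equality) (use unique in blast)+
  then show ?thesis
    by (subst complex_pl_def) (simp add: ts)
qed

lemma complex_pl_norm_elem:
  "pl_norm complex_pl (elem_tensor hilbert_module (complex_pl :: ('h, complex) pl_space) \<xi> c) =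
    cmod c * norm (\<xi> :: 'h::complex_hilbert)"
  using complex_pl_norm[of 1 "\<lambda>_. \<xi>" "\<lambda>_. c"] by (simp add: CC.tensor_sum_Suc)

text \<open>With all scalars moved to the Hilbert side, every tensor becomes elementary. The norm
  axioms and the PL axiom for \<open>complex_pl\<close> thereby reduce to facts about vectors and
  operators of \<open>H\<close>.\<close>

lemma tensor_sum_complex_pl:
  fixes \<xi> :: "nat \<Rightarrow> 'h::complex_hilbert"
  defines "C \<equiv> complex_pl :: ('h, complex) pl_space"
  shows "tensor_sum C n \<xi> c = elem_tensor hilbert_module C (\<Sum>k<n. c k *\<^sub>C \<xi> k) 1"
  unfolding C_def
proof (induction n)
  case 0
  show ?case
    by simp
next
  case (Suc n)
  then show ?case
    using CC.el_smult_right[of 1 "\<xi> n" "c n"]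
    by (simp add: CC.tensor_sum_Suc CC.el_add_left CC.el_scaleC_left)
qed

lemma normed_pl_space_complex_pl: "normed_pl_space (complex_pl :: ('h::complex_hilbert, complex) pl_space)"
proof -
  let ?C = "complex_pl :: ('h, complex) pl_space"
  let ?HC = "H_tensor ?C :: (complex, ('h \<times> complex \<Rightarrow>\<^sub>0 complex) set) module"
  have ex: "\<exists>\<xi>::'h. u = CC.el \<xi> 1" if "u \<in> carrier ?HC" for u
    using that by (rule CC.tensor_sum_exhaust) (auto simp: tensor_sum_complex_pl)
  \<comment> \<open>The zero tensor is the empty sum, so the norm formula with \<open>n = 0\<close>
    evaluates it.\<close>
  have "CC.el \<xi> 1 = \<zero>\<^bsub>?HC\<^esub> \<longleftrightarrow> \<xi> = 0" for \<xi> :: 'h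
    using complex_pl_norm_elem[of \<xi> 1] complex_pl_norm[of 0 "\<lambda>_. 0 :: 'h"] by auto
  moreover have "CC.el 0 1 = \<zero>\<^bsub>?HC\<^esub>" "pl_norm ?C \<zero>\<^bsub>?HC\<^esub> = 0"
    using complex_pl_norm[of 0 "\<lambda>_. 0 :: 'h"] by simp_all
  ultimately have "is_norm ?HC (pl_norm ?C)"
    unfolding is_norm_def
    by (auto dest!: ex simp: complex_pl_norm_elem norm_triangle_ineq
        simp flip: CC.el_add_left CC.el_scaleC_left)
  moreover have "pl_norm ?C (H_action ?C a u) \<le> onorm a * pl_norm ?C u"
    if a: "clinear_map a" "bounded_linear a" and u: "u \<in> carrier ?HC" for a u
  proof -
    obtain \<xi> where \<xi>: "u = CC.el \<xi> 1"
      using ex u by blast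
    then have "H_action ?C a u = CC.el (a \<xi>) 1"
      using CC.H_action_tensor_sum[OF a(1), of 1 "\<lambda>_. 1" "\<lambda>_. \<xi>"] by (simp add: CC.tensor_sum_Suc)
    then show ?thesis
      using onorm[OF a(2)] by (simp add: \<xi> complex_pl_norm_elem)
  qed
  ultimately show ?thesis
    using CC.module_axioms unfolding normed_pl_space_def by blast
qed

section \<open>Strongly measurable functions\<close>

context complex_normed
begin

lemma strongly_measurable_const:
  "x \<in> carrier V \<Longrightarrow> strongly_measurable M V N (\<lambda>_. x)"
  using norm_eq_zero[of "x \<ominus> x"] unfolding strongly_measurable_def
  by (intro exI[of _ "\<lambda>_ _. x"]) auto

lemma strongly_measurable_cong:
  "(\<And>t. t \<in> space M \<Longrightarrow> f t = g t) \<Longrightarrow> strongly_measurable M V N f = strongly_measurable M V N g"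
  by (simp add: strongly_measurable_def cong: conj_cong)

lemma norm_add_diff_le:
  assumes "x \<in> carrier V" "y \<in> carrier V" "x' \<in> carrier V" "y' \<in> carrier V"
  shows "N ((x \<oplus> y) \<ominus> (x' \<oplus> y')) \<le> N (x \<ominus> x') + N (y \<ominus> y')"
proof -
  have "(x \<oplus> y) \<ominus> (x' \<oplus> y') = (x \<ominus> x') \<oplus> (y \<ominus> y')"
    using assms by (simp add: a_minus_def M.minus_add M.a_ac)
  then show ?thesis
    using norm_triangle[of "x \<ominus> x'" "y \<ominus> y'"] assms by simp
qed

lemma strongly_measurable_add:
  assumes f: "strongly_measurable M V N f" "f \<in> space M \<rightarrow> carrier V"
    and g: "strongly_measurable M V N g" "g \<in> space M \<rightarrow> carrier V"
  shows "strongly_measurable M V N (\<lambda>t. f t \<oplus> g t)"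
proof -
  obtain s s' where s: "\<And>n. simple_function M (s n)" "\<And>n. s n \<in> space M \<rightarrow> carrier V"
      "\<And>t. t \<in> space M \<Longrightarrow> (\<lambda>n. N (s n t \<ominus> f t)) \<longlonglongrightarrow> 0"
    and s': "\<And>n. simple_function M (s' n)" "\<And>n. s' n \<in> space M \<rightarrow> carrier V"
      "\<And>t. t \<in> space M \<Longrightarrow> (\<lambda>n. N (s' n t \<ominus> g t)) \<longlonglongrightarrow> 0"
    using f(1) g(1) unfolding strongly_measurable_def by blast
  have "(\<lambda>n. N ((s n t \<oplus> s' n t) \<ominus> (f t \<oplus> g t))) \<longlonglongrightarrow> 0" if t: "t \<in> space M" for t
  proof (rule tendsto_sandwich[of "\<lambda>_. 0"])
    show "(\<lambda>n. N (s n t \<ominus> f t) + N (s' n t \<ominus> g t)) \<longlonglongrightarrow> 0"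
      using tendsto_add[OF s(3)[OF t] s'(3)[OF t]] by simp
  qed (use f(2) g(2) s(2) s'(2) t in \<open>auto simp: Pi_iff intro!: always_eventually norm_nonneg norm_add_diff_le\<close>)
  then show ?thesis
    unfolding strongly_measurable_def using s s'
    by (intro exI[of _ "\<lambda>n t. s n t \<oplus> s' n t"]) (auto simp: Pi_iff intro: simple_function_compose2)
qed

text \<open>A Lipschitz map sends approximating simple functions to approximating simple functions;
  the error grows at most by the factor \<open>C\<close>.\<close>

lemma strongly_measurable_compose:
  assumes "complex_normed W N'" and f: "strongly_measurable M V N f" "f \<in> space M \<rightarrow> carrier V"
    and L: "L \<in> carrier V \<rightarrow> carrier W"
      "\<And>x y. x \<in> carrier V \<Longrightarrow> y \<in> carrier V \<Longrightarrow> N' (L x \<ominus>\<^bsub>W\<^esub> L y) \<le> C * N (x \<ominus> y)"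
  shows "strongly_measurable M W N' (\<lambda>t. L (f t))"
proof -
  interpret W: complex_normed W N' by fact
  obtain s where s: "\<And>n. simple_function M (s n)" "\<And>n. s n \<in> space M \<rightarrow> carrier V"
      "\<And>t. t \<in> space M \<Longrightarrow> (\<lambda>n. N (s n t \<ominus> f t)) \<longlonglongrightarrow> 0"
    using f(1) unfolding strongly_measurable_def by blast
  have "(\<lambda>n. N' (L (s n t) \<ominus>\<^bsub>W\<^esub> L (f t))) \<longlonglongrightarrow> 0" if t: "t \<in> space M" for t
  proof (rule tendsto_sandwich[of "\<lambda>_. 0"])
    show "(\<lambda>n. C * N (s n t \<ominus> f t)) \<longlonglongrightarrow> 0"
      using tendsto_mult_left[OF s(3)[OF t], of C] by simp
  qed (use f(2) s(2) t L in \<open>auto simp: Pi_iff intro!: always_eventually W.norm_nonneg\<close>)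
  then show ?thesis
    unfolding strongly_measurable_def using s L(1)
    by (intro exI[of _ "\<lambda>n t. L (s n t)"]) (auto simp: Pi_iff intro: simple_function_compose1)
qed

text \<open>By the reverse triangle inequality the norm is a pointwise limit of norms of simple
  functions.\<close>

lemma borel_measurable_norm:
  assumes f: "strongly_measurable M V N f" "f \<in> space M \<rightarrow> carrier V"
  shows "(\<lambda>t. N (f t)) \<in> borel_measurable M"
proof -
  obtain s where s: "\<And>n. simple_function M (s n)" "\<And>n. s n \<in> space M \<rightarrow> carrier V"
      "\<And>t. t \<in> space M \<Longrightarrow> (\<lambda>n. N (s n t \<ominus> f t)) \<longlonglongrightarrow> 0"
    using f(1) unfolding strongly_measurable_def by blast
  show ?thesis
  proof (rule borel_measurable_LIMSEQ_real)
    show "(\<lambda>n. N (s n t)) \<longlonglongrightarrow> N (f t)" if t: "t \<in> space M" for t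
    proof (rule LIM_zero_cancel, rule Lim_null_comparison)
      show "\<forall>\<^sub>F n in sequentially. norm (N (s n t) - N (f t)) \<le> N (s n t \<ominus> f t)"
        using s(2) f(2) t by (auto simp: Pi_iff intro!: always_eventually norm_triangle_sub)
    qed (rule s(3)[OF t])
    show "(\<lambda>t. N (s n t)) \<in> borel_measurable M" for n
      by (intro borel_measurable_simple_function simple_function_compose1[OF s(1)])
  qed
qed

end

section \<open>Bochner spaces\<close>

text \<open>From \<open>a + b \<le> 2 * max a b\<close>. The constant is crude, but only
  integrability of the power of a sum is at stake.\<close>

lemma powr_add_le:
  fixes a b p :: real
  assumes "0 \<le> a" "0 \<le> b" "0 \<le> p"
  shows "(a + b) powr p \<le> 2 powr p * (a powr p + b powr p)"
proof -
  have "(a + b) powr p \<le> (2 * max a b) powr p"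
    using assms by (intro powr_mono2) auto
  also have "\<dots> = 2 powr p * max a b powr p"
    using assms by (simp add: powr_mult)
  also have "\<dots> \<le> 2 powr p * (a powr p + b powr p)"
    by (intro mult_left_mono) (auto simp: max_def)
  finally show ?thesis .
qed

locale bochner = complex_normed V N
  for V :: "(complex, 'v, 'm) module_scheme" (structure) and N :: "'v \<Rightarrow> real" +
  fixes M :: "'x measure" and p :: real
  assumes p_ge_1: "1 \<le> p"
begin

abbreviation "Lp \<equiv> Lp_fun p M V N"
abbreviation "null \<equiv> Lp_null p M V N"
abbreviation "cls \<equiv> Lp_class p M V N"

lemma Lp_fun_simps [simp]:
  "f \<oplus>\<^bsub>Lp\<^esub> g = (\<lambda>t\<in>space M. f t \<oplus> g t)" "c \<odot>\<^bsub>Lp\<^esub> f = (\<lambda>t\<in>space M. c \<odot> f t)"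
  "\<zero>\<^bsub>Lp\<^esub> = (\<lambda>t\<in>space M. \<zero>)"
  by (simp_all add: Lp_fun_def)

lemma Lp_fun_value: "f \<in> carrier Lp \<Longrightarrow> t \<in> space M \<Longrightarrow> f t \<in> carrier V"
  by (auto simp: Lp_fun_def)

lemma Lp_funD:
  assumes "f \<in> carrier Lp"
  shows "strongly_measurable M V N f" "f \<in> space M \<rightarrow> carrier V" "f \<in> extensional (space M)"
    "integrable M (\<lambda>t. N (f t) powr p)"
  using assms by (auto simp: Lp_fun_def PiE_def)

text \<open>Domination by an integrable \<open>g\<close> is enough, as strong measurability makes
  the power of the norm measurable. The restriction appears because members of \<open>Lp_fun\<close>
  are extensional.\<close>

lemma Lp_funI:
  assumes f: "strongly_measurable M V N f" "f \<in> space M \<rightarrow> carrier V"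
    and g: "integrable M g" "\<And>t. t \<in> space M \<Longrightarrow> N (f t) powr p \<le> g t"
  shows "(\<lambda>t\<in>space M. f t) \<in> carrier Lp"
proof -
  have "integrable M (\<lambda>t. N (f t) powr p)"
  proof (rule Bochner_Integration.integrable_bound[OF g(1)])
    show "(\<lambda>t. N (f t) powr p) \<in> borel_measurable M"
      using borel_measurable_norm[OF f] by simp
    show "AE t in M. norm (N (f t) powr p) \<le> norm (g t)"
      using g(2) by (auto intro!: AE_I2 order_trans[OF _ abs_ge_self])
  qed
  then have "integrable M (\<lambda>t. N ((\<lambda>t\<in>space M. f t) t) powr p)"
    by (rule Bochner_Integration.integrable_cong[THEN iffD1, rotated 2]) auto
  moreover have "strongly_measurable M V N (\<lambda>t\<in>space M. f t)"
    using f(1) strongly_measurable_cong[of M f "\<lambda>t\<in>space M. f t"] by simp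
  ultimately show ?thesis
    using f(2) by (simp add: Lp_fun_def)
qed

lemma Lp_fun_add_closed:
  assumes "f \<in> carrier Lp" "g \<in> carrier Lp"
  shows "(\<lambda>t\<in>space M. f t \<oplus> g t) \<in> carrier Lp"
proof (rule Lp_funI)
  show "strongly_measurable M V N (\<lambda>t. f t \<oplus> g t)"
    using assms by (intro strongly_measurable_add Lp_funD)
  show "integrable M (\<lambda>t. 2 powr p * (N (f t) powr p + N (g t) powr p))"
    using assms by (intro Bochner_Integration.integrable_mult_right Bochner_Integration.integrable_add Lp_funD)
  show "N (f t \<oplus> g t) powr p \<le> 2 powr p * (N (f t) powr p + N (g t) powr p)" if "t \<in> space M" for t
  proof -
    have "f t \<in> carrier V" "g t \<in> carrier V"
      using assms that by (auto intro: Lp_fun_value)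
    then have "N (f t \<oplus> g t) powr p \<le> (N (f t) + N (g t)) powr p"
      using p_ge_1 by (intro powr_mono2 norm_triangle) auto
    also have "\<dots> \<le> 2 powr p * (N (f t) powr p + N (g t) powr p)"
      using \<open>f t \<in> carrier V\<close> \<open>g t \<in> carrier V\<close> p_ge_1 by (intro powr_add_le) auto
    finally show ?thesis .
  qed
qed (use assms in \<open>auto intro: Lp_fun_value\<close>)

lemma Lp_fun_zero_closed: "(\<lambda>t\<in>space M. \<zero>) \<in> carrier Lp"
  by (rule Lp_funI[of _ "\<lambda>_. 0"]) (auto intro: strongly_measurable_const)

text \<open>With \<open>L \<zero> = \<zero>\<close> the Lipschitz condition also bounds the size of
  \<open>L (f t)\<close>. The lemma serves scalar multiples, the functions
  \<open>t \<mapsto> \<xi> (f t)\<close> with values in \<open>HE\<close>, and the functions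
  \<open>t \<mapsto> z(t) x\<close>.\<close>

lemma Lp_fun_compose:
  assumes W: "complex_normed W N'" and f: "f \<in> carrier Lp"
    and L: "L \<in> carrier V \<rightarrow> carrier W" "L \<zero> = \<zero>\<^bsub>W\<^esub>"
      "\<And>x y. x \<in> carrier V \<Longrightarrow> y \<in> carrier V \<Longrightarrow> N' (L x \<ominus>\<^bsub>W\<^esub> L y) \<le> C * N (x \<ominus> y)"
  shows "(\<lambda>t\<in>space M. L (f t)) \<in> carrier (Lp_fun p M W N')"
proof -
  interpret W: bochner W N' M p
    using W p_ge_1 by (simp add: bochner_def bochner_axioms_def)
  show ?thesis
  proof (rule W.Lp_funI)
    show "strongly_measurable M W N' (\<lambda>t. L (f t))"
      using Lp_funD[OF f] by (intro strongly_measurable_compose[OF W _ _ L(1,3)])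
    \<comment> \<open>No sign is assumed for \<open>C\<close>; the absolute value lets the power
      split over the product.\<close>
    show "integrable M (\<lambda>t. \<bar>C\<bar> powr p * N (f t) powr p)"
      using f by (intro Bochner_Integration.integrable_mult_right Lp_funD)
    show "N' (L (f t)) powr p \<le> \<bar>C\<bar> powr p * N (f t) powr p" if "t \<in> space M" for t
    proof -
      have ft: "f t \<in> carrier V"
        using f that by (rule Lp_fun_value)
      then have "N' (L (f t)) \<le> C * N (f t)"
        using L(3)[of "f t" \<zero>] L(1,2) by (auto simp: Pi_iff)
      also have "\<dots> \<le> \<bar>C\<bar> * N (f t)"
        using ft by (intro mult_right_mono) auto
      finally have "N' (L (f t)) powr p \<le> (\<bar>C\<bar> * N (f t)) powr p"
        using L(1) ft p_ge_1 by (intro powr_mono2) (auto simp: Pi_iff)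
      then show ?thesis
        using ft by (simp add: powr_mult)
    qed
  qed (use L(1) f in \<open>auto intro: Lp_fun_value\<close>)
qed

lemma Lp_fun_smult_closed: "f \<in> carrier Lp \<Longrightarrow> (\<lambda>t\<in>space M. c \<odot> f t) \<in> carrier Lp"
  by (rule Lp_fun_compose[OF complex_normed_axioms, of f "\<lambda>x. c \<odot> x" "cmod c"])
    (auto simp: norm_smult simp flip: smult_diff_right)

lemma Lp_fun_eqI:
  assumes "f \<in> carrier Lp" "g \<in> carrier Lp" "\<And>t. t \<in> space M \<Longrightarrow> f t = g t"
  shows "f = g"
  by (rule extensionalityI[of _ "space M"]) (use assms in \<open>auto intro: Lp_funD\<close>)

lemma complex_linear_Lp_fun: "complex_linear Lp"
proof (rule complex_linearI)
  show "abelian_group Lp"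
  proof (rule abelian_groupI)
    fix f assume f: "f \<in> carrier Lp"
    have "(\<lambda>t\<in>space M. (-1) \<odot> f t) \<oplus>\<^bsub>Lp\<^esub> f = \<zero>\<^bsub>Lp\<^esub>"
      using f by (auto simp: fun_eq_iff Lp_fun_value M.l_neg simp flip: minus_eq_smult)
    then show "\<exists>g\<in>carrier Lp. g \<oplus>\<^bsub>Lp\<^esub> f = \<zero>\<^bsub>Lp\<^esub>"
      using Lp_fun_smult_closed[OF f] by blast
    show "\<zero>\<^bsub>Lp\<^esub> \<oplus>\<^bsub>Lp\<^esub> f = f"
      using Lp_fun_add_closed[OF Lp_fun_zero_closed f] f
      by (intro Lp_fun_eqI) (simp_all add: Lp_fun_value cong: restrict_cong)
  qed (auto intro: Lp_fun_add_closed Lp_fun_zero_closed restrict_ext simp: Lp_fun_value M.a_ac)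
  show "1 \<odot>\<^bsub>Lp\<^esub> f = f" if "f \<in> carrier Lp" for f
    using that Lp_fun_smult_closed[OF that, of 1] by (intro Lp_fun_eqI) (simp_all add: Lp_fun_value)
qed (auto intro: Lp_fun_smult_closed restrict_ext
    simp: Lp_fun_value smult_add_left smult_add_right smult_mult)

sublocale L: complex_quotient null Lp
proof -
  interpret Lp: complex_linear Lp
    by (rule complex_linear_Lp_fun)
  have smult: "c \<odot>\<^bsub>Lp\<^esub> f \<in> null" if "f \<in> null" for c f
    using that by (auto simp: Lp_null_def Lp_fun_smult_closed elim: eventually_mono)
  have "submodule null complex_ring Lp"
  proof (rule Lp.submoduleI)
    show "\<zero>\<^bsub>Lp\<^esub> \<in> null"
      by (auto simp: Lp_null_def Lp_fun_zero_closed)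
    show "\<ominus>\<^bsub>Lp\<^esub> f \<in> null" if "f \<in> null" for f
      using smult[OF that, of "-1"] that by (simp add: Lp.minus_eq_smult Lp_null_def)
    show "f \<oplus>\<^bsub>Lp\<^esub> g \<in> null" if "f \<in> null" "g \<in> null" for f g
      using that by (auto simp: Lp_null_def Lp_fun_add_closed elim: eventually_elim2)
  qed (use smult in \<open>auto simp: Lp_null_def\<close>)
  then show "complex_quotient null Lp"
    by (intro complex_quotient.intro complex_linear_Lp_fun)
qed

lemma Lp_space_eq: "Lp_space p M V N = L.Q"
  by (simp add: Lp_space_def)

lemma cls_eq: "cls f = null +>\<^bsub>Lp\<^esub> f"
  by (simp add: Lp_class_def)

lemma carrier_Lp_space: "carrier (Lp_space p M V N) = cls ` carrier Lp"
  by (simp add: Lp_space_eq L.carrier_quotient cls_eq)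

lemma cls_add: "f \<in> carrier Lp \<Longrightarrow> g \<in> carrier Lp \<Longrightarrow>
    cls f \<oplus>\<^bsub>Lp_space p M V N\<^esub> cls g = cls (\<lambda>t\<in>space M. f t \<oplus> g t)"
  using L.quotient_add[of f g] by (simp add: Lp_space_eq cls_eq)

lemma cls_smult: "f \<in> carrier Lp \<Longrightarrow> c \<odot>\<^bsub>Lp_space p M V N\<^esub> cls f = cls (\<lambda>t\<in>space M. c \<odot> f t)"
  using L.quotient_smult[of f c] by (simp add: Lp_space_eq cls_eq)

lemma cls_eq_iff:
  assumes "f \<in> carrier Lp" "g \<in> carrier Lp"
  shows "cls f = cls g \<longleftrightarrow> (AE t in M. f t = g t)"
proof -
  \<comment> \<open>Subtraction in \<open>Lp\<close> is derived from the record. Written as addition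
    of the multiple by -1, it inherits the pointwise formulas for sums and multiples.\<close>
  have diff: "f \<ominus>\<^bsub>Lp\<^esub> g = (\<lambda>t\<in>space M. f t \<ominus> g t)"
  proof -
    have "f \<ominus>\<^bsub>Lp\<^esub> g = f \<oplus>\<^bsub>Lp\<^esub> (-1) \<odot>\<^bsub>Lp\<^esub> g"
      by (simp only: a_minus_def L.minus_eq_smult[OF assms(2)])
    also have "\<dots> = (\<lambda>t\<in>space M. f t \<ominus> g t)"
      unfolding Lp_fun_simps
      by (rule restrict_ext) (simp add: a_minus_def minus_eq_smult Lp_fun_value[OF assms(2)])
    finally show ?thesis .
  qed
  have "cls f = cls g \<longleftrightarrow> f \<ominus>\<^bsub>Lp\<^esub> g \<in> null"
    using assms by (simp add: cls_eq L.coset_eq_iff)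
  also have "\<dots> \<longleftrightarrow> (AE t in M. (f \<ominus>\<^bsub>Lp\<^esub> g) t = \<zero>)"
    using L.minus_closed[OF assms] by (simp only: Lp_null_def mem_Collect_eq simp_thms)
  also have "\<dots> \<longleftrightarrow> (AE t in M. f t = g t)"
    using assms by (intro AE_cong) (simp add: diff Lp_fun_value)
  finally show ?thesis .
qed

lemma mem_clsD:
  assumes "f \<in> carrier Lp" "g \<in> cls f"
  shows "g \<in> carrier Lp" "AE t in M. g t = f t"
proof -
  show g: "g \<in> carrier Lp"
    using assms L.a_elemrcos_carrier[of f g] by (simp add: cls_eq)
  have "cls g = cls f"
    using assms L.a_repr_independence'[of g f] by (simp add: cls_eq)
  then show "AE t in M. g t = f t"
    using cls_eq_iff[OF g assms(1)] by simp
qed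

lemma mem_cls_self: "f \<in> carrier Lp \<Longrightarrow> f \<in> cls f"
  unfolding cls_eq by (rule L.a_rcos_self)

end

section \<open>The PL-norm on Bochner spaces\<close>

locale pl_bochner = pl_normed E
  for E :: "('h::complex_hilbert, 'e) pl_space" +
  fixes M :: "'x measure" and p :: real
  assumes p_ge_1: "1 \<le> p"
begin

text \<open>The prefix \<open>B\<close> refers to functions with values in \<open>E\<close>,
  \<open>HB\<close> to functions with values in \<open>HE\<close> under the PL-norm, and
  \<open>G\<close> to tensors over the space \<open>Lp_pl p M E\<close> of classes.\<close>

sublocale B: bochner E nrm M p
  by unfold_locales (rule p_ge_1)

sublocale HB: bochner HE "pl_norm E" M p
  by unfold_locales (rule p_ge_1)

sublocale G: pl_linear "Lp_pl p M E"
  using B.L.quotient_linear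
  by (simp add: pl_linear_def Lp_pl_def complex_linear_extend_pl B.Lp_space_eq)

lemma Lp_pl_simps [simp]:
  "carrier (Lp_pl p M E) = B.cls ` carrier B.Lp"
  "A \<oplus>\<^bsub>Lp_pl p M E\<^esub> A' = A \<oplus>\<^bsub>Lp_space p M E nrm\<^esub> A'"
  "c \<odot>\<^bsub>Lp_pl p M E\<^esub> A = c \<odot>\<^bsub>Lp_space p M E nrm\<^esub> A"
  by (simp_all add: Lp_pl_def B.carrier_Lp_space)

text \<open>The map \<open>el \<xi>\<close> is Lipschitz with constant \<open>norm \<xi>\<close>,
  because the PL-norm of an elementary tensor is a product. The instance with scalar 0 says that it
  preserves zero.\<close>

lemma el_in_Lp:
  assumes "f \<in> carrier B.Lp"
  shows "(\<lambda>t\<in>space M. el \<xi> (f t)) \<in> carrier HB.Lp"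
  by (rule B.Lp_fun_compose[OF P.complex_normed_axioms assms, of _ "norm \<xi>"])
    (use el_smult_right[of "\<zero>\<^bsub>E\<^esub>" \<xi> 0] in \<open>auto simp: pl_norm_elem simp flip: el_diff_right\<close>)

lemma tensor_sum_in_Lp:
  fixes \<xi> :: "nat \<Rightarrow> 'h"
  assumes "\<And>k. k < n \<Longrightarrow> f k \<in> carrier B.Lp"
  shows "(\<lambda>t\<in>space M. tensor_sum E n \<xi> (\<lambda>k. f k t)) \<in> carrier HB.Lp"
  using assms
proof (induction n)
  case 0
  show ?case
    unfolding tensor_sum_0 by (rule HB.Lp_fun_zero_closed)
next
  case (Suc n)
  have eq: "(\<lambda>t\<in>space M. tensor_sum E (Suc n) \<xi> (\<lambda>k. f k t)) =
    (\<lambda>t\<in>space M. (\<lambda>t\<in>space M. tensor_sum E n \<xi> (\<lambda>k. f k t)) t \<oplus>\<^bsub>HE\<^esub> (\<lambda>t\<in>space M. el (\<xi> n) (f n t)) t)"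
    using Suc.prems by (auto simp: tensor_sum_Suc B.Lp_fun_value intro!: restrict_ext)
  show ?case
    unfolding eq using Suc by (intro HB.Lp_fun_add_closed el_in_Lp) auto
qed

text \<open>A non-integrable function has integral 0 by default, so this is what gives content to
  the norm formula of \<open>Lp_pl\<close>. Monotonicity of the integral relies on it as
  well.\<close>

lemma integrable_pl_norm_tensor_sum:
  fixes \<xi> :: "nat \<Rightarrow> 'h"
  assumes "\<And>k. k < n \<Longrightarrow> f k \<in> carrier B.Lp"
  shows "integrable M (\<lambda>t. pl_norm E (tensor_sum E n \<xi> (\<lambda>k. f k t)) powr p)"
proof -
  have "integrable M (\<lambda>t. pl_norm E ((\<lambda>t\<in>space M. tensor_sum E n \<xi> (\<lambda>k. f k t)) t) powr p)"
    using assms by (intro HB.Lp_funD tensor_sum_in_Lp)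
  then show ?thesis
    by (rule Bochner_Integration.integrable_cong[THEN iffD1, rotated 2]) auto
qed

text \<open>Evaluation at \<open>t\<close> becomes possible after choosing a representative
  \<open>rep A\<close> of each class, and is then linear almost everywhere for each fixed choice of
  arguments. This is the eventual universal property along the filter of the measure. Only finitely
  many classes occur, so replacing the chosen representatives by the given functions costs one more
  null set.\<close>

lemma AE_tensor_sum_eq:
  fixes \<xi> \<eta> :: "nat \<Rightarrow> 'h"
  assumes f: "\<And>k. k < m \<Longrightarrow> f k \<in> carrier B.Lp" and g: "\<And>k. k < n \<Longrightarrow> g k \<in> carrier B.Lp"
    and eq: "tensor_sum (Lp_pl p M E) m \<xi> (\<lambda>k. B.cls (f k)) = tensor_sum (Lp_pl p M E) n \<eta> (\<lambda>k. B.cls (g k))"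
  shows "AE t in M. tensor_sum E m \<xi> (\<lambda>k. f k t) = tensor_sum E n \<eta> (\<lambda>k. g k t)"
proof -
  define rep where "rep A = (SOME f. f \<in> A)" for A :: "('x \<Rightarrow> 'e) set"
  \<comment> \<open>Outside the space the chosen functions need not take values in \<open>E\<close>.
    The zero tensor there keeps \<open>b t\<close> inside \<open>HE\<close> for every
    \<open>t\<close>, as the lift demands.\<close>
  define b where "b = (\<lambda>t \<xi> A. if t \<in> space M then el \<xi> (rep A t) else \<zero>\<^bsub>HE\<^esub>)"
  have rep: "rep (B.cls f) \<in> carrier B.Lp" "AE t in M. rep (B.cls f) t = f t"
    if "f \<in> carrier B.Lp" for f
  proof -
    have "rep (B.cls f) \<in> B.cls f"
      unfolding rep_def by (rule someI[of _ f]) (rule B.mem_cls_self[OF that])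
    then show "rep (B.cls f) \<in> carrier B.Lp" "AE t in M. rep (B.cls f) t = f t"
      using B.mem_clsD[OF that] by blast+
  qed
  have b: "AE t in M. \<forall>k\<in>{..<n}. b t (\<zeta> k) (B.cls (f k)) = el (\<zeta> k) (f k t)"
    if "\<And>k. k < n \<Longrightarrow> f k \<in> carrier B.Lp" for n :: nat and f and \<zeta> :: "nat \<Rightarrow> 'h"
  proof (rule AE_finite_allI)
    fix k assume "k \<in> {..<n}"
    then have "AE t in M. rep (B.cls (f k)) t = f k t"
      using rep(2)[OF that] by simp
    then show "AE t in M. b t (\<zeta> k) (B.cls (f k)) = el (\<zeta> k) (f k t)"
      using AE_space by eventually_elim (simp add: b_def)
  qed simp
  have bf: "AE t in M. \<forall>k\<in>{..<m}. b t (\<xi> k) (B.cls (f k)) = el (\<xi> k) (f k t)"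
    using f by (rule b)
  have bg: "AE t in M. \<forall>k\<in>{..<n}. b t (\<eta> k) (B.cls (g k)) = el (\<eta> k) (g k t)"
    using g by (rule b)
  have "AE t in M. (\<Oplus>\<^bsub>HE\<^esub>k\<in>{..<m}. b t (\<xi> k) (B.cls (f k))) = (\<Oplus>\<^bsub>HE\<^esub>k\<in>{..<n}. b t (\<eta> k) (B.cls (g k)))"
  proof (rule G.tensor_sum_eq_eventually_lift[OF H.T.complex_linear_axioms _ _ _ _ _ _ _ eq])
    fix \<zeta> \<zeta>' :: 'h and c t
    fix A assume "A \<in> carrier (Lp_pl p M E)"
    then obtain f where f: "f \<in> carrier B.Lp" "A = B.cls f"
      by auto
    have val: "rep A t \<in> carrier E" if "t \<in> space M" for t
      using B.Lp_fun_value[OF rep(1)[OF f(1)] that] f by simp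
    show "b t \<zeta> A \<in> carrier HE"
      using val by (simp add: b_def)
    \<comment> \<open>In the Hilbert variable the representative stays the same and linearity holds
      at every point. In the class variable the representative of a sum or multiple is chosen anew
      and fits only almost everywhere.\<close>
    show "AE t in M. b t (\<zeta> + \<zeta>') A = b t \<zeta> A \<oplus>\<^bsub>HE\<^esub> b t \<zeta>' A"
      using val by (intro always_eventually) (simp add: b_def el_add_left)
    show "AE t in M. b t (c *\<^sub>C \<zeta>) A = c \<odot>\<^bsub>HE\<^esub> b t \<zeta> A"
      using val by (intro always_eventually) (simp add: b_def el_scaleC_left)
    show "AE t in M. b t \<zeta> (c \<odot>\<^bsub>Lp_pl p M E\<^esub> A) = c \<odot>\<^bsub>HE\<^esub> b t \<zeta> A"
      using rep(2)[OF f(1)] rep(2)[OF B.Lp_fun_smult_closed[OF f(1), of c]] AE_space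
    proof eventually_elim
      case (elim t)
      then show ?case
        using B.Lp_fun_value[OF f(1)] by (simp add: b_def f(2) B.cls_smult[OF f(1)] el_smult_right)
    qed
    fix A' assume "A' \<in> carrier (Lp_pl p M E)"
    then obtain f' where f': "f' \<in> carrier B.Lp" "A' = B.cls f'"
      by auto
    show "AE t in M. b t \<zeta> (A \<oplus>\<^bsub>Lp_pl p M E\<^esub> A') = b t \<zeta> A \<oplus>\<^bsub>HE\<^esub> b t \<zeta> A'"
      using rep(2)[OF f(1)] rep(2)[OF f'(1)] rep(2)[OF B.Lp_fun_add_closed[OF f(1) f'(1)]] AE_space
    proof eventually_elim
      case (elim t)
      then show ?case
        using B.Lp_fun_value[OF f(1)] B.Lp_fun_value[OF f'(1)]
        by (simp add: b_def f(2) f'(2) B.cls_add[OF f(1) f'(1)] el_add_right)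
    qed
  qed (use f g in auto)
  then show ?thesis
    using bf bg AE_space
  proof eventually_elim
    case (elim t)
    have "(\<Oplus>\<^bsub>HE\<^esub>k\<in>{..<m}. b t (\<xi> k) (B.cls (f k))) = tensor_sum E m \<xi> (\<lambda>k. f k t)"
      unfolding tensor_sum_def by (rule H.T.finsum_cong') (use elim f in \<open>auto simp: B.Lp_fun_value\<close>)
    moreover have "(\<Oplus>\<^bsub>HE\<^esub>k\<in>{..<n}. b t (\<eta> k) (B.cls (g k))) = tensor_sum E n \<eta> (\<lambda>k. g k t)"
      unfolding tensor_sum_def by (rule H.T.finsum_cong') (use elim g in \<open>auto simp: B.Lp_fun_value\<close>)
    ultimately show ?case
      using elim by simp
  qed
qed

text \<open>Any other representation has almost everywhere the same integrand, hence the same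
  integral, so the description of the norm has this unique value.\<close>

proposition pl_norm_Lp_pl:
  fixes \<xi> :: "nat \<Rightarrow> 'h"
  assumes f: "\<And>k. k < n \<Longrightarrow> f k \<in> carrier B.Lp"
  shows "pl_norm (Lp_pl p M E) (tensor_sum (Lp_pl p M E) n \<xi> (\<lambda>k. B.cls (f k))) =
    (LINT t|M. pl_norm E (tensor_sum E n \<xi> (\<lambda>k. f k t)) powr p) powr (1 / p)"
    (is "_ = ?r")
proof -
  have ts: "tensor_sum (Lp_space p M E nrm) m \<eta> A = tensor_sum (Lp_pl p M E) m \<eta> A"
    for m A and \<eta> :: "nat \<Rightarrow> 'h"
    by (simp add: Lp_pl_def)
  have unique: "(LINT t|M. pl_norm E (tensor_sum E m \<eta> (\<lambda>k. g k t)) powr p) powr (1 / p) = ?r"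
    if "\<And>k. k < m \<Longrightarrow> g k \<in> carrier B.Lp"
      "tensor_sum (Lp_pl p M E) n \<xi> (\<lambda>k. B.cls (f k)) = tensor_sum (Lp_pl p M E) m \<eta> (\<lambda>k. B.cls (g k))"
    for m g and \<eta> :: "nat \<Rightarrow> 'h"
  proof -
    have "AE t in M. tensor_sum E n \<xi> (\<lambda>k. f k t) = tensor_sum E m \<eta> (\<lambda>k. g k t)"
      using f that by (rule AE_tensor_sum_eq)
    then have "AE t in M. pl_norm E (tensor_sum E m \<eta> (\<lambda>k. g k t)) powr p = pl_norm E (tensor_sum E n \<xi> (\<lambda>k. f k t)) powr p"
      by eventually_elim simp
    moreover have "integrable M (\<lambda>t. pl_norm E (tensor_sum E m \<eta> (\<lambda>k. g k t)) powr p)"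
      using that(1) by (rule integrable_pl_norm_tensor_sum)
    moreover have "integrable M (\<lambda>t. pl_norm E (tensor_sum E n \<xi> (\<lambda>k. f k t)) powr p)"
      using f by (rule integrable_pl_norm_tensor_sum)
    ultimately have "(LINT t|M. pl_norm E (tensor_sum E m \<eta> (\<lambda>k. g k t)) powr p) =
        (LINT t|M. pl_norm E (tensor_sum E n \<xi> (\<lambda>k. f k t)) powr p)"
      by (intro integral_cong_AE borel_measurable_integrable)
    then show ?thesis
      by simp
  qed
  have "(THE r. \<exists>m (\<eta> :: nat \<Rightarrow> 'h) g. (\<forall>k<m. g k \<in> carrier B.Lp) \<and>
        tensor_sum (Lp_pl p M E) n \<xi> (\<lambda>k. B.cls (f k)) = tensor_sum (Lp_pl p M E) m \<eta> (\<lambda>k. B.cls (g k)) \<and>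
        r = (LINT t|M. pl_norm E (tensor_sum E m \<eta> (\<lambda>k. g k t)) powr p) powr (1 / p)) = ?r"
    (is "(THE r. ?P r) = _")
  proof (rule the_equality)
    show "?P ?r"
      using f by blast
    fix r assume "?P r"
    then obtain m g and \<eta> :: "nat \<Rightarrow> 'h" where "\<And>k. k < m \<Longrightarrow> g k \<in> carrier B.Lp"
        "tensor_sum (Lp_pl p M E) n \<xi> (\<lambda>k. B.cls (f k)) = tensor_sum (Lp_pl p M E) m \<eta> (\<lambda>k. B.cls (g k))"
        "r = (LINT t|M. pl_norm E (tensor_sum E m \<eta> (\<lambda>k. g k t)) powr p) powr (1 / p)"
      by blast
    with unique show "r = ?r"
      by metis
  qed
  moreover have "pl_norm (Lp_pl p M E) = (\<lambda>u. THE r. \<exists>m (\<eta> :: nat \<Rightarrow> 'h) g. (\<forall>k<m. g k \<in> carrier B.Lp) \<and>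
        u = tensor_sum (Lp_space p M E nrm) m \<eta> (\<lambda>k. B.cls (g k)) \<and>
        r = (LINT t|M. pl_norm E (tensor_sum E m \<eta> (\<lambda>k. g k t)) powr p) powr (1 / p))"
    unfolding Lp_pl_def by (rule pl_norm_extend)
  ultimately show ?thesis
    by (simp only: ts)
qed

lemma Lp_pl_exhaust:
  assumes "u \<in> carrier (H_tensor (Lp_pl p M E) :: (complex, ('h \<times> ('x \<Rightarrow> 'e) set \<Rightarrow>\<^sub>0 complex) set) module)"
  obtains n \<xi> f where "\<And>k. k < n \<Longrightarrow> f k \<in> carrier B.Lp"
    "u = tensor_sum (Lp_pl p M E) n \<xi> (\<lambda>k. B.cls (f k))"
proof -
  obtain n \<xi> A where A: "\<And>k. k < n \<Longrightarrow> A k \<in> carrier (Lp_pl p M E)" and u: "u = tensor_sum (Lp_pl p M E) n \<xi> A"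
    by (rule G.tensor_sum_exhaust[OF assms]) (rule that)
  have "\<forall>k. \<exists>f. k < n \<longrightarrow> f \<in> carrier B.Lp \<and> A k = B.cls f"
    using A by auto
  then obtain f where f: "\<And>k. k < n \<Longrightarrow> f k \<in> carrier B.Lp \<and> A k = B.cls (f k)"
    by metis
  have "u = tensor_sum (Lp_pl p M E) n \<xi> (\<lambda>k. B.cls (f k))"
    unfolding u by (rule G.tensor_sum_cong) (use f in auto)
  with f that show ?thesis
    by blast
qed

end

section \<open>Amplifications\<close>

text \<open>The representations are exchanged one at a time: for a fixed representation of the
  second tensor, the value is bilinear in the terms of the first, and conversely.\<close>

lemma amplification_tensor_sum:
  fixes E :: "('h::complex_hilbert, 'e) pl_space" and F :: "('h, 'f) pl_space" and G :: "('h, 'g) pl_space"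
    and \<xi> \<eta> :: "nat \<Rightarrow> 'h"
  assumes E: "pl_linear E" and F: "pl_linear F" and G: "pl_linear G"
    and R: "bilinear_operator E F G R"
    and dia: "\<And>\<xi> \<xi>' \<eta>. dia (\<xi> + \<xi>') \<eta> = dia \<xi> \<eta> + dia \<xi>' \<eta>"
      "\<And>\<xi> \<eta> \<eta>'. dia \<xi> (\<eta> + \<eta>') = dia \<xi> \<eta> + dia \<xi> \<eta>'"
      "\<And>c \<xi> \<eta>. dia (c *\<^sub>C \<xi>) \<eta> = c *\<^sub>C dia \<xi> \<eta>" "\<And>c \<xi> \<eta>. dia \<xi> (c *\<^sub>C \<eta>) = c *\<^sub>C dia \<xi> \<eta>"
    and x: "\<And>i. i < m \<Longrightarrow> x i \<in> carrier E" and y: "\<And>k. k < n \<Longrightarrow> y k \<in> carrier F"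
  shows "amplification dia E F G R (tensor_sum E m \<xi> x) (tensor_sum F n \<eta> y) =
    (\<Oplus>\<^bsub>H_tensor G\<^esub>i\<in>{..<m}. tensor_sum G n (\<lambda>k. dia (\<xi> i) (\<eta> k)) (\<lambda>k. R (x i) (y k)))"
proof -
  interpret E: pl_linear E by fact
  interpret F: pl_linear F by fact
  interpret G: pl_linear G by fact
  note R = R[unfolded bilinear_operator_def]
  have R_closed: "R a b \<in> carrier G" if "a \<in> carrier E" "b \<in> carrier F" for a b
    using R that by blast
  define D where "D = (\<lambda>m \<xi> x n \<eta> y.
    \<Oplus>\<^bsub>H_tensor G\<^esub>i\<in>{..<m::nat}. tensor_sum G n (\<lambda>k. dia (\<xi> i) (\<eta> k)) (\<lambda>k. R (x i) (y k)))"
  have unique: "D m \<xi> x n \<eta> y = D m' \<xi>' x' n' \<eta>' y'"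
    if x': "\<And>i. i < m' \<Longrightarrow> x' i \<in> carrier E" and y': "\<And>k. k < n' \<Longrightarrow> y' k \<in> carrier F"
      and eqE: "tensor_sum E m \<xi> x = tensor_sum E m' \<xi>' x'"
      and eqF: "tensor_sum F n \<eta> y = tensor_sum F n' \<eta>' y'"
    for m' \<xi>' x' n' \<eta>' y'
  proof -
    have "D m \<xi> x n \<eta> y = D m' \<xi>' x' n \<eta> y"
      unfolding D_def
    proof (rule E.tensor_sum_eq_lift[OF G.H.T.complex_linear_axioms _ _ _ _ _ x x' eqE,
            where B = "\<lambda>\<xi> x. tensor_sum G n (\<lambda>k. dia \<xi> (\<eta> k)) (\<lambda>k. R x (y k))"])
      fix \<zeta> \<zeta>' :: 'h and c
      fix a assume a: "a \<in> carrier E"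
      note Ra = R_closed[OF a y]
      show "tensor_sum G n (\<lambda>k. dia \<zeta> (\<eta> k)) (\<lambda>k. R a (y k)) \<in> carrier (H_tensor G)"
        using Ra by simp
      show "tensor_sum G n (\<lambda>k. dia (\<zeta> + \<zeta>') (\<eta> k)) (\<lambda>k. R a (y k)) =
          tensor_sum G n (\<lambda>k. dia \<zeta> (\<eta> k)) (\<lambda>k. R a (y k)) \<oplus>\<^bsub>H_tensor G\<^esub>
          tensor_sum G n (\<lambda>k. dia \<zeta>' (\<eta> k)) (\<lambda>k. R a (y k))"
        using Ra by (simp add: dia G.tensor_sum_add_left)
      show "tensor_sum G n (\<lambda>k. dia (c *\<^sub>C \<zeta>) (\<eta> k)) (\<lambda>k. R a (y k)) =
          c \<odot>\<^bsub>H_tensor G\<^esub> tensor_sum G n (\<lambda>k. dia \<zeta> (\<eta> k)) (\<lambda>k. R a (y k))"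
        using Ra by (simp add: dia G.tensor_sum_scaleC_left)
      have "tensor_sum G n (\<lambda>k. dia \<zeta> (\<eta> k)) (\<lambda>k. R (c \<odot>\<^bsub>E\<^esub> a) (y k)) =
          tensor_sum G n (\<lambda>k. dia \<zeta> (\<eta> k)) (\<lambda>k. c \<odot>\<^bsub>G\<^esub> R a (y k))"
        by (rule G.tensor_sum_cong) (use R a y Ra in auto)
      then show "tensor_sum G n (\<lambda>k. dia \<zeta> (\<eta> k)) (\<lambda>k. R (c \<odot>\<^bsub>E\<^esub> a) (y k)) =
          c \<odot>\<^bsub>H_tensor G\<^esub> tensor_sum G n (\<lambda>k. dia \<zeta> (\<eta> k)) (\<lambda>k. R a (y k))"
        using Ra by (simp add: G.tensor_sum_smult_right)
      fix b assume b: "b \<in> carrier E"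
      note Rb = R_closed[OF b y]
      have "tensor_sum G n (\<lambda>k. dia \<zeta> (\<eta> k)) (\<lambda>k. R (a \<oplus>\<^bsub>E\<^esub> b) (y k)) =
          tensor_sum G n (\<lambda>k. dia \<zeta> (\<eta> k)) (\<lambda>k. R a (y k) \<oplus>\<^bsub>G\<^esub> R b (y k))"
        by (rule G.tensor_sum_cong) (use R a b y Ra Rb in auto)
      then show "tensor_sum G n (\<lambda>k. dia \<zeta> (\<eta> k)) (\<lambda>k. R (a \<oplus>\<^bsub>E\<^esub> b) (y k)) =
          tensor_sum G n (\<lambda>k. dia \<zeta> (\<eta> k)) (\<lambda>k. R a (y k)) \<oplus>\<^bsub>H_tensor G\<^esub>
          tensor_sum G n (\<lambda>k. dia \<zeta> (\<eta> k)) (\<lambda>k. R b (y k))"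
        using Ra Rb by (simp add: G.tensor_sum_add_right)
    qed
    \<comment> \<open>With the first representation exchanged, both sides are sums over the same
      \<open>i\<close>, and the second is exchanged in each summand separately.\<close>
    also have "\<dots> = D m' \<xi>' x' n' \<eta>' y'"
      unfolding D_def
    proof (rule G.H.T.finsum_cong')
      fix i assume i: "i \<in> {..<m'}"
      show "tensor_sum G n (\<lambda>k. dia (\<xi>' i) (\<eta> k)) (\<lambda>k. R (x' i) (y k)) =
          tensor_sum G n' (\<lambda>k. dia (\<xi>' i) (\<eta>' k)) (\<lambda>k. R (x' i) (y' k))"
        unfolding tensor_sum_def[of G]
        by (rule F.tensor_sum_eq_lift[OF G.H.T.complex_linear_axioms _ _ _ _ _ y y' eqF,
              where B = "\<lambda>\<eta> y. G.el (dia (\<xi>' i) \<eta>) (R (x' i) y)"])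
          (use R i x' in \<open>auto simp: dia G.el_add_left G.el_add_right G.el_scaleC_left G.el_smult_right\<close>)
    qed (use x' y' in \<open>auto intro!: R_closed G.tensor_sum_closed\<close>)
    finally show ?thesis .
  qed
  show ?thesis
    unfolding amplification_def
  proof (rule the_equality)
    fix w assume "\<exists>m' \<xi>' x' n' \<eta>' y'. (\<forall>i<m'. x' i \<in> carrier E) \<and> tensor_sum E m \<xi> x = tensor_sum E m' \<xi>' x' \<and>
       (\<forall>k<n'. y' k \<in> carrier F) \<and> tensor_sum F n \<eta> y = tensor_sum F n' \<eta>' y' \<and>
        w = (\<Oplus>\<^bsub>H_tensor G\<^esub>i\<in>{..<m'}. tensor_sum G n' (\<lambda>k. dia (\<xi>' i) (\<eta>' k)) (\<lambda>k. R (x' i) (y' k)))"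
    then obtain m' \<xi>' x' n' \<eta>' y' where
       *: "\<And>i. i < m' \<Longrightarrow> x' i \<in> carrier E" "\<And>k. k < n' \<Longrightarrow> y' k \<in> carrier F"
        "tensor_sum E m \<xi> x = tensor_sum E m' \<xi>' x'" "tensor_sum F n \<eta> y = tensor_sum F n' \<eta>' y'"
        and w: "w = D m' \<xi>' x' n' \<eta>' y'"
      unfolding D_def by blast
    show "w = (\<Oplus>\<^bsub>H_tensor G\<^esub>i\<in>{..<m}. tensor_sum G n (\<lambda>k. dia (\<xi> i) (\<eta> k)) (\<lambda>k. R (x i) (y k)))"
      using unique[OF *] unfolding w by (simp only: D_def)
  qed (use x y in blast)
qed

section \<open>The product \<open>\<diamond>\<close> on the Hilbert space\<close>

locale diamond_product =
  fixes \<iota> :: "'t::complex_hilbert \<Rightarrow> 'h::complex_hilbert"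
    and j :: "('h \<times> 'h \<Rightarrow>\<^sub>0 complex) set \<Rightarrow> 't"
  assumes j: "hilbert_tensor_product j" and \<iota>: "unitary \<iota>"
begin

abbreviation dia where "dia \<equiv> diamond \<iota> j"

lemma
  shows dia_add_left: "dia (\<xi> + \<xi>') \<eta> = dia \<xi> \<eta> + dia \<xi>' \<eta>"
    and dia_add_right: "dia \<xi> (\<eta> + \<eta>') = dia \<xi> \<eta> + dia \<xi> \<eta>'"
    and dia_scaleC_left: "dia (c *\<^sub>C \<xi>) \<eta> = c *\<^sub>C dia \<xi> \<eta>"
    and dia_scaleC_right: "dia \<xi> (c *\<^sub>C \<eta>) = c *\<^sub>C dia \<xi> \<eta>"
    and norm_dia: "norm (dia \<xi> \<eta>) = norm \<xi> * norm \<eta>"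
proof -
  interpret T: tensor_pair "hilbert_module :: (complex, 'h) module" "hilbert_module :: (complex, 'h) module"
    by (intro tensor_pair.intro complex_linear_hilbert_module)
  let ?e = "elem_tensor hilbert_module hilbert_module :: 'h \<Rightarrow> 'h \<Rightarrow> _"
  have add: "j (u \<oplus>\<^bsub>T.T\<^esub> v) = j u + j v" if "u \<in> carrier T.T" "v \<in> carrier T.T" for u v
    using j that by (simp add: hilbert_tensor_product_def Let_def)
  have smult: "j (c \<odot>\<^bsub>T.T\<^esub> u) = c *\<^sub>C j u" if "u \<in> carrier T.T" for c u
    using j that by (simp add: hilbert_tensor_product_def Let_def)
  have cinner: "cinner (j (?e \<xi> \<eta>)) (j (?e \<xi>' \<eta>')) = cinner \<xi> \<xi>' * cinner \<eta> \<eta>'" for \<xi> \<eta> \<xi>' \<eta>'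
    using j unfolding hilbert_tensor_product_def Let_def by blast
  have e: "?e \<xi> \<eta> \<in> carrier T.T" for \<xi> \<eta>
    by (rule T.elem_closed) simp_all
  have lin: "\<iota> (x + y) = \<iota> x + \<iota> y" "\<iota> (c *\<^sub>C x) = c *\<^sub>C \<iota> x" "cinner (\<iota> x) (\<iota> y) = cinner x y" for x y c
    using \<iota> by (simp_all add: unitary_def clinear_map_def)
  show "dia (\<xi> + \<xi>') \<eta> = dia \<xi> \<eta> + dia \<xi>' \<eta>"
    using T.elem_add_left[of \<xi> \<xi>' \<eta>] by (simp add: diamond_def add e lin)
  show "dia \<xi> (\<eta> + \<eta>') = dia \<xi> \<eta> + dia \<xi> \<eta>'"
    using T.elem_add_right[of \<xi> \<eta> \<eta>'] by (simp add: diamond_def add e lin)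
  show "dia (c *\<^sub>C \<xi>) \<eta> = c *\<^sub>C dia \<xi> \<eta>"
    using T.elem_smult_left[of \<xi> \<eta> c] by (simp add: diamond_def smult e lin)
  show "dia \<xi> (c *\<^sub>C \<eta>) = c *\<^sub>C dia \<xi> \<eta>"
    using T.elem_smult_right[of \<xi> \<eta> c] by (simp add: diamond_def smult e lin)
  have "complex_of_real ((norm (dia \<xi> \<eta>))\<^sup>2) = complex_of_real ((norm \<xi> * norm \<eta>)\<^sup>2)"
    unfolding cinner_self[symmetric] by (simp add: diamond_def lin cinner) (simp add: cinner_self power_mult_distrib)
  then show "norm (dia \<xi> \<eta>) = norm \<xi> * norm \<eta>"
    by (simp only: of_real_eq_iff) (simp add: power2_eq_iff_nonneg)
qed

text \<open>Holding the left factor fixed turns \<open>\<diamond>\<close> into operators on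
  \<open>H\<close>, to which the PL axiom can be applied.\<close>

lemma
  shows clinear_dia: "clinear_map (dia \<xi>)"
    and bounded_linear_dia: "bounded_linear (dia \<xi>)"
    and onorm_dia_le: "onorm (dia \<xi>) \<le> norm \<xi>"
proof -
  show "clinear_map (dia \<xi>)"
    by (simp add: clinear_map_def dia_add_right dia_scaleC_right)
  show "bounded_linear (dia \<xi>)"
    by (rule bounded_linear_intro[of _ "norm \<xi>"])
      (simp_all add: dia_add_right dia_scaleC_right norm_dia mult.commute flip: scaleC_of_real)
  show "onorm (dia \<xi>) \<le> norm \<xi>"
    by (rule onorm_bound) (simp_all add: norm_dia)
qed

end

section \<open>Multiplication of a vector by a scalar function\<close>

locale scalar_times = pl_bochner E M p
  for E :: "('h::complex_hilbert, 'e) pl_space" and M :: "'x measure" and p :: real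
begin

sublocale C: pl_bochner "complex_pl :: ('h, complex) pl_space" M p
  by unfold_locales (use normed_pl_space_complex_pl unit_vector p_ge_1 in auto)

abbreviation CP :: "('h, complex) pl_space" where "CP \<equiv> complex_pl"
abbreviation "R \<equiv> scalar_times_vector p M E"

text \<open>The map \<open>c \<mapsto> c x\<close> is Lipschitz with constant the underlying norm of
  \<open>x\<close>.\<close>

lemma scalar_times_in_Lp:
  assumes "z \<in> carrier C.B.Lp" "x \<in> carrier E"
  shows "(\<lambda>t\<in>space M. z t \<odot>\<^bsub>E\<^esub> x) \<in> carrier B.Lp"
proof -
  obtain \<xi> :: 'h where \<xi>: "norm \<xi> = 1"
    using unit_vector by blast
  \<comment> \<open>Membership of \<open>z\<close> in \<open>C.B.Lp\<close> is phrased with the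
    underlying norm of \<open>complex_pl\<close>, which first has to be recognised as the
    modulus.\<close>
  have "C.nrm c = cmod c" for c
    using C.underlying_norm_eq[OF \<xi>, of c] complex_pl_norm_elem[of \<xi> c] \<xi> by simp
  moreover have "a \<odot>\<^bsub>E\<^esub> x \<ominus>\<^bsub>E\<^esub> b \<odot>\<^bsub>E\<^esub> x = (a - b) \<odot>\<^bsub>E\<^esub> x" for a b
    using smult_add_left[OF assms(2), of a "-b"] smult_mult[OF assms(2), of "-1" b] assms(2)
    by (simp add: a_minus_def minus_eq_smult)
  ultimately show ?thesis
    using assms(2)
    by (intro C.B.Lp_fun_compose[OF complex_normed_axioms assms(1), of _ "nrm x"])
      (auto simp: norm_smult mult.commute)
qed

text \<open>Representatives that agree almost everywhere have products with \<open>x\<close> that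
  agree almost everywhere, so every choice of \<open>z\<close> gives the same class.\<close>

lemma scalar_times_vector_cls:
  assumes z: "z \<in> carrier C.B.Lp" and x: "x \<in> carrier E"
  shows "R (C.B.cls z) x = B.cls (\<lambda>t\<in>space M. z t \<odot>\<^bsub>E\<^esub> x)"
  unfolding scalar_times_vector_def
proof (rule the_equality)
  show "\<exists>z'\<in>C.B.cls z. B.cls (\<lambda>t\<in>space M. z t \<odot>\<^bsub>E\<^esub> x) = B.cls (\<lambda>t\<in>space M. z' t \<odot>\<^bsub>E\<^esub> x)"
    using C.B.mem_cls_self[OF z] by blast
  fix A assume "\<exists>z'\<in>C.B.cls z. A = B.cls (\<lambda>t\<in>space M. z' t \<odot>\<^bsub>E\<^esub> x)"
  then obtain z' where z': "z' \<in> C.B.cls z" and A: "A = B.cls (\<lambda>t\<in>space M. z' t \<odot>\<^bsub>E\<^esub> x)"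
    by blast
  note z' = C.B.mem_clsD[OF z z']
  have "AE t in M. (\<lambda>t\<in>space M. z' t \<odot>\<^bsub>E\<^esub> x) t = (\<lambda>t\<in>space M. z t \<odot>\<^bsub>E\<^esub> x) t"
    using z'(2) by eventually_elim (simp add: restrict_def)
  then show "A = B.cls (\<lambda>t\<in>space M. z t \<odot>\<^bsub>E\<^esub> x)"
    unfolding A using B.cls_eq_iff[OF scalar_times_in_Lp[OF z'(1) x] scalar_times_in_Lp[OF z x]] by blast
qed

lemma bilinear_scalar_times_vector: "bilinear_operator (Lp_pl p M CP) E (Lp_pl p M E) R"
proof -
  have 1: "R (C.B.cls z) x \<in> B.cls ` carrier B.Lp"
    if "z \<in> carrier C.B.Lp" "x \<in> carrier E" for z x
    using that by (simp add: scalar_times_vector_cls scalar_times_in_Lp)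
  have 2: "R (C.B.cls z \<oplus>\<^bsub>Lp_space p M CP C.nrm\<^esub> C.B.cls z') x =
      R (C.B.cls z) x \<oplus>\<^bsub>Lp_space p M E nrm\<^esub> R (C.B.cls z') x"
    if "z \<in> carrier C.B.Lp" "z' \<in> carrier C.B.Lp" "x \<in> carrier E" for z z' x
  proof -
    have "R (C.B.cls z \<oplus>\<^bsub>Lp_space p M CP C.nrm\<^esub> C.B.cls z') x =
        B.cls (\<lambda>t\<in>space M. (\<lambda>t\<in>space M. z t \<oplus>\<^bsub>CP\<^esub> z' t) t \<odot>\<^bsub>E\<^esub> x)"
      unfolding C.B.cls_add[OF that(1,2)]
      using that C.B.Lp_fun_add_closed[OF that(1,2)] by (intro scalar_times_vector_cls)
    \<comment> \<open>The inner restrictions are kept so that the function literally matches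
      \<open>B.cls_add\<close> for two restricted functions.\<close>
    also have "(\<lambda>t\<in>space M. (\<lambda>t\<in>space M. z t \<oplus>\<^bsub>CP\<^esub> z' t) t \<odot>\<^bsub>E\<^esub> x) =
        (\<lambda>t\<in>space M. (\<lambda>t\<in>space M. z t \<odot>\<^bsub>E\<^esub> x) t \<oplus>\<^bsub>E\<^esub> (\<lambda>t\<in>space M. z' t \<odot>\<^bsub>E\<^esub> x) t)"
      using that(3) by (intro restrict_ext) (simp add: smult_add_left)
    also have "B.cls \<dots> = R (C.B.cls z) x \<oplus>\<^bsub>Lp_space p M E nrm\<^esub> R (C.B.cls z') x"
      using that by (simp only: scalar_times_vector_cls B.cls_add scalar_times_in_Lp)
    finally show ?thesis .
  qed
  have 3: "R (C.B.cls z) (x \<oplus>\<^bsub>E\<^esub> x') = R (C.B.cls z) x \<oplus>\<^bsub>Lp_space p M E nrm\<^esub> R (C.B.cls z) x'"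
    if "z \<in> carrier C.B.Lp" "x \<in> carrier E" "x' \<in> carrier E" for z x x'
  proof -
    have "R (C.B.cls z) (x \<oplus>\<^bsub>E\<^esub> x') = B.cls (\<lambda>t\<in>space M. z t \<odot>\<^bsub>E\<^esub> (x \<oplus>\<^bsub>E\<^esub> x'))"
      using that by (intro scalar_times_vector_cls) auto
    also have "(\<lambda>t\<in>space M. z t \<odot>\<^bsub>E\<^esub> (x \<oplus>\<^bsub>E\<^esub> x')) =
        (\<lambda>t\<in>space M. (\<lambda>t\<in>space M. z t \<odot>\<^bsub>E\<^esub> x) t \<oplus>\<^bsub>E\<^esub> (\<lambda>t\<in>space M. z t \<odot>\<^bsub>E\<^esub> x') t)"
      using that by (intro restrict_ext) (simp add: smult_add_right)
    also have "B.cls \<dots> = R (C.B.cls z) x \<oplus>\<^bsub>Lp_space p M E nrm\<^esub> R (C.B.cls z) x'"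
      using that by (simp only: scalar_times_vector_cls B.cls_add scalar_times_in_Lp)
    finally show ?thesis .
  qed
  have 4: "R (c \<odot>\<^bsub>Lp_space p M CP C.nrm\<^esub> C.B.cls z) x = c \<odot>\<^bsub>Lp_space p M E nrm\<^esub> R (C.B.cls z) x"
    if "z \<in> carrier C.B.Lp" "x \<in> carrier E" for c z x
  proof -
    have "R (c \<odot>\<^bsub>Lp_space p M CP C.nrm\<^esub> C.B.cls z) x =
        B.cls (\<lambda>t\<in>space M. (\<lambda>t\<in>space M. c \<odot>\<^bsub>CP\<^esub> z t) t \<odot>\<^bsub>E\<^esub> x)"
      unfolding C.B.cls_smult[OF that(1)]
      using that C.B.Lp_fun_smult_closed[OF that(1)] by (intro scalar_times_vector_cls)
    also have "(\<lambda>t\<in>space M. (\<lambda>t\<in>space M. c \<odot>\<^bsub>CP\<^esub> z t) t \<odot>\<^bsub>E\<^esub> x) =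
        (\<lambda>t\<in>space M. c \<odot>\<^bsub>E\<^esub> (\<lambda>t\<in>space M. z t \<odot>\<^bsub>E\<^esub> x) t)"
      using that by (intro restrict_ext) (simp add: smult_mult)
    also have "B.cls \<dots> = c \<odot>\<^bsub>Lp_space p M E nrm\<^esub> R (C.B.cls z) x"
      using that by (simp only: scalar_times_vector_cls B.cls_smult scalar_times_in_Lp)
    finally show ?thesis .
  qed
  have 5: "R (C.B.cls z) (c \<odot>\<^bsub>E\<^esub> x) = c \<odot>\<^bsub>Lp_space p M E nrm\<^esub> R (C.B.cls z) x"
    if "z \<in> carrier C.B.Lp" "x \<in> carrier E" for c z x
  proof -
    have "R (C.B.cls z) (c \<odot>\<^bsub>E\<^esub> x) = B.cls (\<lambda>t\<in>space M. z t \<odot>\<^bsub>E\<^esub> (c \<odot>\<^bsub>E\<^esub> x))"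
      using that by (intro scalar_times_vector_cls) auto
    also have "(\<lambda>t\<in>space M. z t \<odot>\<^bsub>E\<^esub> (c \<odot>\<^bsub>E\<^esub> x)) =
        (\<lambda>t\<in>space M. c \<odot>\<^bsub>E\<^esub> (\<lambda>t\<in>space M. z t \<odot>\<^bsub>E\<^esub> x) t)"
      using that by (intro restrict_ext) (simp add: mult.commute flip: smult_mult)
    also have "B.cls \<dots> = c \<odot>\<^bsub>Lp_space p M E nrm\<^esub> R (C.B.cls z) x"
      using that by (simp only: scalar_times_vector_cls B.cls_smult scalar_times_in_Lp)
    finally show ?thesis .
  qed
  show ?thesis
    unfolding bilinear_operator_def Lp_pl_simps C.Lp_pl_simps
    \<comment> \<open>The carriers are images under \<open>cls\<close>; \<open>ball_simps\<close>
      turns quantification over classes into quantification over functions.\<close>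
    by (simp only: ball_simps) (intro conjI allI ballI 1 2 3 4 5)
qed

text \<open>The estimate at one point, with \<open>z i\<close> a scalar. Scalars move from the
  vectors into the left factor of \<open>\<diamond>\<close>, after which all inner sums share the
  vectors \<open>x\<close> and the outer sum enters that factor too.\<close>

lemma pl_norm_scalar_times_le:
  fixes \<xi> \<eta> :: "nat \<Rightarrow> 'h"
  assumes dia: "diamond_product \<iota> j" and x: "\<And>k. k < n \<Longrightarrow> x k \<in> carrier E"
  shows "pl_norm E (\<Oplus>\<^bsub>HE\<^esub>i\<in>{..<m}. tensor_sum E n (\<lambda>k. diamond \<iota> j (\<xi> i) (\<eta> k)) (\<lambda>k. z i \<odot>\<^bsub>E\<^esub> x k))
    \<le> norm (\<Sum>i<m. z i *\<^sub>C \<xi> i) * pl_norm E (tensor_sum E n \<eta> x)"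
proof -
  interpret diamond_product \<iota> j by fact
  have "(\<Oplus>\<^bsub>HE\<^esub>i\<in>{..<m}. tensor_sum E n (\<lambda>k. dia (\<xi> i) (\<eta> k)) (\<lambda>k. z i \<odot>\<^bsub>E\<^esub> x k)) =
      (\<Oplus>\<^bsub>HE\<^esub>i\<in>{..<m}. tensor_sum E n (\<lambda>k. dia (z i *\<^sub>C \<xi> i) (\<eta> k)) x)"
    using x by (intro H.T.finsum_cong')
      (auto simp: tensor_sum_smult_right tensor_sum_scaleC_left dia_scaleC_left)
  also have "\<dots> = tensor_sum E n (\<lambda>k. \<Sum>i<m. dia (z i *\<^sub>C \<xi> i) (\<eta> k)) x"
    using x by (intro tensor_sum_sum_left[symmetric])
  also have "(\<lambda>k. \<Sum>i<m. dia (z i *\<^sub>C \<xi> i) (\<eta> k)) = (\<lambda>k. dia (\<Sum>i<m. z i *\<^sub>C \<xi> i) (\<eta> k))"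
  proof
    fix k
    \<comment> \<open>The empty sum is the base case; its value is read off from the norm.\<close>
    have "dia 0 (\<eta> k) = 0"
      using norm_dia[of 0 "\<eta> k"] by simp
    then show "(\<Sum>i<m. dia (z i *\<^sub>C \<xi> i) (\<eta> k)) = dia (\<Sum>i<m. z i *\<^sub>C \<xi> i) (\<eta> k)"
      by (induction m) (simp_all add: dia_add_left)
  qed
  finally have "pl_norm E (\<Oplus>\<^bsub>HE\<^esub>i\<in>{..<m}. tensor_sum E n (\<lambda>k. dia (\<xi> i) (\<eta> k)) (\<lambda>k. z i \<odot>\<^bsub>E\<^esub> x k))
      \<le> onorm (dia (\<Sum>i<m. z i *\<^sub>C \<xi> i)) * pl_norm E (tensor_sum E n \<eta> x)"
    using pl_norm_tensor_sum_le[OF clinear_dia bounded_linear_dia x] by simp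
  also have "\<dots> \<le> norm (\<Sum>i<m. z i *\<^sub>C \<xi> i) * pl_norm E (tensor_sum E n \<eta> x)"
    using x onorm_dia_le by (intro mult_right_mono) auto
  finally show ?thesis .
qed

proposition pl_norm_amplification_le:
  assumes dia: "diamond_product \<iota> j"
    and u: "u \<in> carrier (H_tensor (Lp_pl p M CP) :: (complex, ('h \<times> ('x \<Rightarrow> complex) set \<Rightarrow>\<^sub>0 complex) set) module)"
    and v: "v \<in> carrier HE"
  shows "pl_norm (Lp_pl p M E) (amplification (diamond \<iota> j) (Lp_pl p M CP) E (Lp_pl p M E) R u v)
    \<le> pl_norm (Lp_pl p M CP) u * pl_norm E v"
proof -
  interpret diamond_product \<iota> j by fact
  obtain m \<xi> z where z: "\<And>i. i < m \<Longrightarrow> z i \<in> carrier C.B.Lp"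
    and u_eq: "u = tensor_sum (Lp_pl p M CP) m \<xi> (\<lambda>i. C.B.cls (z i))"
    by (rule C.Lp_pl_exhaust[OF u]) (rule that)
  obtain n \<eta> x where x: "\<And>k. k < n \<Longrightarrow> x k \<in> carrier E" and v_eq: "v = tensor_sum E n \<eta> x"
    by (rule tensor_sum_exhaust[OF v]) (rule that)
  define f where "f = (\<lambda>i k. \<lambda>t\<in>space M. z i t \<odot>\<^bsub>E\<^esub> x k)"
  have f: "f i k \<in> carrier B.Lp" if "i < m" "k < n" for i k
    unfolding f_def using z x that by (intro scalar_times_in_Lp)
  have dm: "l div n < m" "l mod n < n" if "l < m * n" for l
    using that by (cases "n = 0"; simp add: less_mult_imp_div_less)+
  \<comment> \<open>The norm formula for \<open>Lp_pl\<close> needs a singly indexed sum, so the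
    pairs \<open>(i, k)\<close> are flattened into \<open>l\<close>. This \<open>\<zeta>\<close> is
    the flattened family of Hilbert vectors, not the function \<open>\<zeta>(t)\<close> of the
    overview.\<close>
  define \<zeta> where "\<zeta> = (\<lambda>l. dia (\<xi> (l div n)) (\<eta> (l mod n)))"
  define g where "g = (\<lambda>l. f (l div n) (l mod n))"
  have g: "g l \<in> carrier B.Lp" if "l < m * n" for l
    unfolding g_def using dm[OF that] by (intro f)
  let ?GH = "H_tensor (Lp_pl p M E)"
  have "amplification dia (Lp_pl p M CP) E (Lp_pl p M E) R u v =
      (\<Oplus>\<^bsub>?GH\<^esub>i\<in>{..<m}. tensor_sum (Lp_pl p M E) n (\<lambda>k. dia (\<xi> i) (\<eta> k)) (\<lambda>k. R (C.B.cls (z i)) (x k)))"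
    unfolding u_eq v_eq using z x
    by (intro amplification_tensor_sum C.G.pl_linear_axioms G.pl_linear_axioms pl_linear_axioms
        bilinear_scalar_times_vector dia_add_left dia_add_right dia_scaleC_left dia_scaleC_right) auto
  also have "\<dots> = (\<Oplus>\<^bsub>?GH\<^esub>i\<in>{..<m}. tensor_sum (Lp_pl p M E) n (\<lambda>k. dia (\<xi> i) (\<eta> k)) (\<lambda>k. B.cls (f i k)))"
    using z x f by (intro G.H.T.finsum_cong' G.tensor_sum_cong)
      (auto intro!: G.tensor_sum_closed simp: scalar_times_vector_cls f_def)
  also have "\<dots> = tensor_sum (Lp_pl p M E) (m * n) \<zeta> (\<lambda>l. B.cls (g l))"
    unfolding \<zeta>_def g_def using f by (intro G.tensor_sum_mult) auto
  finally have "pl_norm (Lp_pl p M E) (amplification dia (Lp_pl p M CP) E (Lp_pl p M E) R u v) =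
      (LINT t|M. pl_norm E (tensor_sum E (m * n) \<zeta> (\<lambda>l. g l t)) powr p) powr (1 / p)"
    using pl_norm_Lp_pl[OF g] by simp
  also have "\<dots> \<le> (LINT t|M. norm (\<Sum>i<m. z i t *\<^sub>C \<xi> i) powr p * pl_norm E v powr p) powr (1 / p)"
  proof (intro powr_mono2 integral_mono)
    show "integrable M (\<lambda>t. pl_norm E (tensor_sum E (m * n) \<zeta> (\<lambda>l. g l t)) powr p)"
      using g by (rule integrable_pl_norm_tensor_sum)
    \<comment> \<open>Up to a constant factor the majorant is the integrand in the norm of
      \<open>u\<close>, which makes it integrable.\<close>
    show "integrable M (\<lambda>t. norm (\<Sum>i<m. z i t *\<^sub>C \<xi> i) powr p * pl_norm E v powr p)"
      using C.integrable_pl_norm_tensor_sum[OF z, where \<xi> = \<xi>] by (simp add: complex_pl_norm)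
    fix t assume t: "t \<in> space M"
    \<comment> \<open>At a single point the flattening is undone, now in \<open>HE\<close>, to reach
      the form of the pointwise estimate.\<close>
    have "tensor_sum E (m * n) \<zeta> (\<lambda>l. g l t) =
        (\<Oplus>\<^bsub>HE\<^esub>i\<in>{..<m}. tensor_sum E n (\<lambda>k. dia (\<xi> i) (\<eta> k)) (\<lambda>k. f i k t))"
      unfolding \<zeta>_def g_def using f t by (intro tensor_sum_mult[symmetric] B.Lp_fun_value)
    also have "\<dots> = (\<Oplus>\<^bsub>HE\<^esub>i\<in>{..<m}. tensor_sum E n (\<lambda>k. dia (\<xi> i) (\<eta> k)) (\<lambda>k. z i t \<odot>\<^bsub>E\<^esub> x k))"
      using t by (simp add: f_def)
    finally have "pl_norm E (tensor_sum E (m * n) \<zeta> (\<lambda>l. g l t)) \<le>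
        norm (\<Sum>i<m. z i t *\<^sub>C \<xi> i) * pl_norm E v"
      using pl_norm_scalar_times_le[OF dia x, where m = m and \<xi> = \<xi> and \<eta> = \<eta> and z = "\<lambda>i. z i t"] by (simp add: v_eq)
    moreover have "tensor_sum E (m * n) \<zeta> (\<lambda>l. g l t) \<in> carrier HE"
      using g t by (intro tensor_sum_closed B.Lp_fun_value)
    ultimately have "pl_norm E (tensor_sum E (m * n) \<zeta> (\<lambda>l. g l t)) powr p \<le>
        (norm (\<Sum>i<m. z i t *\<^sub>C \<xi> i) * pl_norm E v) powr p"
      using p_ge_1 by (intro powr_mono2) auto
    then show "pl_norm E (tensor_sum E (m * n) \<zeta> (\<lambda>l. g l t)) powr p \<le>
        norm (\<Sum>i<m. z i t *\<^sub>C \<xi> i) powr p * pl_norm E v powr p"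
      using v by (simp add: powr_mult)
  qed (use p_ge_1 in auto)
  also have "\<dots> = ((LINT t|M. norm (\<Sum>i<m. z i t *\<^sub>C \<xi> i) powr p) * pl_norm E v powr p) powr (1 / p)"
    by simp
  \<comment> \<open>The root cancels the power of \<open>pl_norm E v\<close>, as that norm is
    nonnegative and \<open>p\<close> is nonzero.\<close>
  also have "\<dots> = (LINT t|M. norm (\<Sum>i<m. z i t *\<^sub>C \<xi> i) powr p) powr (1 / p) * pl_norm E v"
    using v p_ge_1 by (simp add: powr_mult powr_powr)
  also have "(LINT t|M. norm (\<Sum>i<m. z i t *\<^sub>C \<xi> i) powr p) powr (1 / p) = pl_norm (Lp_pl p M CP) u"
    unfolding u_eq using C.pl_norm_Lp_pl[OF z, where \<xi> = \<xi>] by (simp add: complex_pl_norm)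
  finally show ?thesis .
qed

end

theorem proposition3p6:
  fixes \<iota> :: "'t::complex_hilbert \<Rightarrow> 'h::complex_hilbert"
    and j :: "('h \<times> 'h \<Rightarrow>\<^sub>0 complex) set \<Rightarrow> 't"
    and M :: "'x measure"
    and p :: real
    and E :: "('h, 'e) pl_space"
  assumes "separable_space (euclidean :: 'h topology)"
    and "infinite_dimensional TYPE('h)"
    and "hilbert_tensor_product j"
    and "unitary \<iota>"
    and "1 \<le> p"
    and "normed_pl_space E"
  shows "L_contractive (diamond \<iota> j)
           (Lp_pl p M complex_pl) E (Lp_pl p M E) (scalar_times_vector p M E)"
proof -
  interpret scalar_times E M p
    using assms infinite_dimensional_imp_unit_vector
    by (simp add: scalar_times_def pl_bochner_def pl_normed_def pl_bochner_axioms_def)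
  have "diamond_product \<iota> j"
    using assms by (simp add: diamond_product_def)
  then show ?thesis
    unfolding L_contractive_def
    using bilinear_scalar_times_vector pl_norm_amplification_le by blast
qed

end
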